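(* Let $\mathcal{M}$ be the set of all lower semicomputable chronological contextual semimeasures. For any Bayesian mixture $\xi$ over $\mathcal{M}$ and every $\varepsilon>0$ there is a Bayesian mixture $\xi'$ over $\mathcal{M}$ such that $$\Upsilon_\xi(\pi^*_{\xi'})<\underline{\Upsilon}_\xi+\varepsilon,$$ where $\pi^*_{\xi'}$ is a $\xi'$-optimal policy.
   Context: The action set $\mathcal{A}$ and the percept set $\mathcal{E}$ are finite; a percept is $e=(o,r)$ with reward $r\in[0,1]$. A history is $\ae_{<t}=a_1e_1\ldots a_{t-1}e_{t-1}\in(\mathcal{A}\times\mathcal{E})^*$, with $\epsilon$ the empty history. A policy maps each history to a probability distribution on $\mathcal{A}$. A chronological contextual semimeasure $\nu$ assigns to all equal-length $e_{1:t}\in\mathcal{E}^t$, $a_{1:t}\in\mathcal{A}^t$ a number $\nu(e_{1:t}\,\|\,a_{1:t})\in[0,1]$ with $\nu(\epsilon\,\|\,\epsilon)\le1$ and $\sum_{e_t\in\mathcal{E}}\nu(e_{1:t}\,\|\,a_{1:t})\le\nu(e_{<t}\,\|\,a_{<t})$. It is lower semicomputable if $\{(e_{1:t},a_{1:t},q):q\in\mathbb{Q},\ \nu(e_{1:t}\,\|\,a_{1:t})>q\}$ is recursively enumerable. A Bayesian mixture over $\mathcal{M}$ is $\xi(e_{1:t}\,\|\,a_{1:t})=\sum_{\nu\in\mathcal{M}}w(\nu)\,\nu(e_{1:t}\,\|\,a_{1:t})$ for a prior probability distribution $w$ on $\mathcal{M}$ with $w(\nu)>0$ for all $\nu$. The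 discount function $\gamma:\mathbb{N}\to\mathbb{R}_{\ge0}$ is computable and summable, $\Gamma_t:=\sum_{k\ge t}\gamma_k$. The value of $\pi$ in $\nu$ after a history with $\nu(e_{<t}\,\|\,a_{<t})>0$ is $$V^\pi_\nu(\ae_{<t})=\frac1{\Gamma_t}\sum_{k=t}^\infty\gamma_k\sum_{\ae_{t:k}}r_k\,\frac{\nu(e_{1:k}\,\|\,a_{1:k})}{\nu(e_{<t}\,\|\,a_{<t})}\prod_{i=t}^k\pi(a_i\mid\ae_{<i})$$ if $\Gamma_t>0$ and $0$ if $\Gamma_t=0$. Put $V^*_\nu(\ae_{<t})=\sup_\pi V^\pi_\nu(\ae_{<t})$; a policy is $\nu$-optimal if $V^\pi_\nu(\ae_{<t})=V^*_\nu(\ae_{<t})$ for all histories. The (Legg–Hutter) intelligence of $\pi$ with respect to the mixture $\xi$ with prior $w$ is $\Upsilon_\xi(\pi):=\sum_{\nu\in\mathcal{M}}w(\nu)V^\pi_\nu(\epsilon)$ (for semimeasures with $\nu(\epsilon\,\|\,\epsilon)<1$ the contribution of $\nu$ is understood without dividing by $\nu(\epsilon\,\|\,\epsilon)$), and $\underline{\Upsilon}_\xi:=\inf_\pi\Upsilon_\xi(\pi)$ over all policies. *)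

theory Defs
  imports "HOL-Probability.Probability" "HOL-Library.Nat_Bijection" "HOL-Library.Countable"
begin

text \<open>Partial recursive functions on tuples of natural numbers: programs and their (partial)
  evaluation. \<open>Minim f\<close> searches for the least \<open>n\<close> with \<open>f (n, xs) = 0\<close>; all smaller arguments must
  converge to a nonzero value.\<close>

datatype recf = Zero | Succ | Proj nat | Comp recf "recf list" | PrimRec recf recf | Minim recf

inductive computes :: "recf \<Rightarrow> nat list \<Rightarrow> nat \<Rightarrow> bool" where
  zero: "computes Zero xs 0"
| succ: "computes Succ [x] (Suc x)"
| proj: "i < length xs \<Longrightarrow> computes (Proj i) xs (xs ! i)"
| comp: "list_all2 (\<lambda>g y. computes g xs y) gs ys \<Longrightarrow> computes f ys z \<Longrightarrow> computes (Comp f gs) xs z"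
| prec_0: "computes f xs y \<Longrightarrow> computes (PrimRec f g) (0 # xs) y"
| prec_Suc: "computes (PrimRec f g) (n # xs) y \<Longrightarrow> computes g (n # y # xs) z
    \<Longrightarrow> computes (PrimRec f g) (Suc n # xs) z"
| minim: "computes f (n # xs) 0 \<Longrightarrow> (\<forall>m<n. \<exists>y>0. computes f (m # xs) y)
    \<Longrightarrow> computes (Minim f) xs n"

definition recursively_enumerable :: "nat set \<Rightarrow> bool" where
  "recursively_enumerable A \<longleftrightarrow> (\<exists>f. A = {n. \<exists>y. computes f [n] y})"

text \<open>Lower semicomputability of \<open>f\<close>, that is, recursive enumerability of \<open>{(x, q). f x > q}\<close> with
  \<open>q\<close> rational. The argument \<open>enc\<close> is the coding of the domain of \<open>f\<close> by natural numbers; a rational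
  is coded by every fraction \<open>p / d\<close> with \<open>d > 0\<close> that represents it.\<close>

definition lower_semicomputable :: "('x \<Rightarrow> nat) \<Rightarrow> ('x \<Rightarrow> real) \<Rightarrow> bool" where
  "lower_semicomputable enc f \<longleftrightarrow> recursively_enumerable
     {prod_encode (enc x, prod_encode (int_encode p, d)) | x p d.
        d > 0 \<and> f x > real_of_int p / real d}"

definition computable_real_fun :: "('x \<Rightarrow> nat) \<Rightarrow> ('x \<Rightarrow> real) \<Rightarrow> bool" where
  "computable_real_fun enc f \<longleftrightarrow>
     lower_semicomputable enc f \<and> lower_semicomputable enc (\<lambda>x. - f x)"

text \<open>The history \<open>a\<^sub>1e\<^sub>1\<dots>a\<^sub>te\<^sub>t\<close> is the list \<open>[(a\<^sub>1,e\<^sub>1), \<dots>, (a\<^sub>t,e\<^sub>t)]\<close>. A pair of equally long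
  sequences \<open>e\<^sub>1\<^sub>:\<^sub>t\<close>, \<open>a\<^sub>1\<^sub>:\<^sub>t\<close> is the same datum, so \<open>\<nu>(e\<^sub>1\<^sub>:\<^sub>t \<parallel> a\<^sub>1\<^sub>:\<^sub>t)\<close> is written \<open>\<nu> h\<close> as well.\<close>

type_synonym ('a, 'e) history = "('a \<times> 'e) list"
type_synonym ('a, 'e) env = "('a, 'e) history \<Rightarrow> real"
type_synonym ('a, 'e) policy = "('a, 'e) history \<Rightarrow> 'a pmf"

text \<open>Here \<^const>\<open>to_nat\<close> is applied to a finite type only, where it is some injective numbering;
  which one is irrelevant for computability. Lists are coded by the explicit \<^const>\<open>list_encode\<close>.\<close>

definition history_encode :: "('a::finite, 'e::finite) history \<Rightarrow> nat" where
  "history_encode h = list_encode (map to_nat h)"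

definition chronological_semimeasure :: "('a::finite, 'e::finite) env \<Rightarrow> bool" where
  "chronological_semimeasure \<nu> \<longleftrightarrow>
     (\<forall>h. 0 \<le> \<nu> h \<and> \<nu> h \<le> 1) \<and> (\<forall>h a. (\<Sum>e\<in>UNIV. \<nu> (h @ [(a, e)])) \<le> \<nu> h)"

definition lsc_envs :: "('a::finite, 'e::finite) env set" where
  "lsc_envs = {\<nu>. chronological_semimeasure \<nu> \<and> lower_semicomputable history_encode \<nu>}"

definition positive_prior :: "('a::finite, 'e::finite) env pmf \<Rightarrow> bool" where
  "positive_prior w \<longleftrightarrow> set_pmf w = lsc_envs"

definition mixture :: "('a::finite, 'e::finite) env pmf \<Rightarrow> ('a, 'e) env" where
  "mixture w h = (\<Sum>\<^sub>\<infinity>\<nu>\<in>lsc_envs. pmf w \<nu> * \<nu> h)"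

text \<open>Time steps are numbered from 1, so \<open>\<gamma> 0\<close> is never used, and the step following a history \<open>h\<close>
  is \<open>t = Suc (length h)\<close>.\<close>

definition discount_tail :: "(nat \<Rightarrow> real) \<Rightarrow> nat \<Rightarrow> real" where
  "discount_tail \<gamma> t = (\<Sum>n. \<gamma> (t + n))"

definition policy_prob :: "('a, 'e) policy \<Rightarrow> ('a, 'e) history \<Rightarrow> ('a, 'e) history \<Rightarrow> real" where
  "policy_prob \<pi> h g = (\<Prod>i<length g. pmf (\<pi> (h @ take i g)) (fst (g ! i)))"

text \<open>The discounted reward sum after \<open>h\<close>, normalised by the discount but not by the probability
  of \<open>h\<close>. The list \<open>g\<close> is the continuation from step \<open>t\<close> to step \<open>k = t + n\<close>.\<close>

definition expected_return ::
  "(nat \<Rightarrow> real) \<Rightarrow> ('e::finite \<Rightarrow> real) \<Rightarrow> ('a::finite, 'e) env \<Rightarrow> ('a, 'e) policy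
     \<Rightarrow> ('a, 'e) history \<Rightarrow> real" where
  "expected_return \<gamma> r \<nu> \<pi> h =
     (let t = Suc (length h) in
      if discount_tail \<gamma> t > 0 then
        1 / discount_tail \<gamma> t *
          (\<Sum>n. \<gamma> (t + n) *
            (\<Sum>g | length g = Suc n. r (snd (last g)) * \<nu> (h @ g) * policy_prob \<pi> h g))
      else 0)"

text \<open>Meaningful for \<open>\<nu> h > 0\<close> only.\<close>

definition policy_value ::
  "(nat \<Rightarrow> real) \<Rightarrow> ('e::finite \<Rightarrow> real) \<Rightarrow> ('a::finite, 'e) env \<Rightarrow> ('a, 'e) policy
     \<Rightarrow> ('a, 'e) history \<Rightarrow> real" where
  "policy_value \<gamma> r \<nu> \<pi> h = expected_return \<gamma> r (\<lambda>h'. \<nu> h' / \<nu> h) \<pi> h"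

definition optimal_value ::
  "(nat \<Rightarrow> real) \<Rightarrow> ('e::finite \<Rightarrow> real) \<Rightarrow> ('a::finite, 'e) env \<Rightarrow> ('a, 'e) history \<Rightarrow> real" where
  "optimal_value \<gamma> r \<nu> h = (SUP \<pi>. policy_value \<gamma> r \<nu> \<pi> h)"

definition optimal_policy ::
  "(nat \<Rightarrow> real) \<Rightarrow> ('e::finite \<Rightarrow> real) \<Rightarrow> ('a::finite, 'e) env \<Rightarrow> ('a, 'e) policy \<Rightarrow> bool" where
  "optimal_policy \<gamma> r \<nu> \<pi> \<longleftrightarrow>
     (\<forall>h. \<nu> h > 0 \<longrightarrow> policy_value \<gamma> r \<nu> \<pi> h = optimal_value \<gamma> r \<nu> h)"

text \<open>The contribution of \<open>\<nu>\<close> to the intelligence is not divided by \<open>\<nu> []\<close>, which may be less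
  than 1; for \<open>\<nu> [] = 1\<close> it is \<open>policy_value \<gamma> r \<nu> \<pi> []\<close>.\<close>

definition intelligence ::
  "(nat \<Rightarrow> real) \<Rightarrow> ('e::finite \<Rightarrow> real) \<Rightarrow> ('a::finite, 'e) env pmf \<Rightarrow> ('a, 'e) policy \<Rightarrow> real" where
  "intelligence \<gamma> r w \<pi> = (\<Sum>\<^sub>\<infinity>\<nu>\<in>lsc_envs. pmf w \<nu> * expected_return \<gamma> r \<nu> \<pi> [])"

definition min_intelligence ::
  "(nat \<Rightarrow> real) \<Rightarrow> ('e::finite \<Rightarrow> real) \<Rightarrow> ('a::finite, 'e) env pmf \<Rightarrow> real" where
  "min_intelligence \<gamma> r w = (INF \<pi>. intelligence \<gamma> r w \<pi>)"

end

theory Submission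
  imports Defs
begin

text \<open>Since the intelligence of \<open>\<pi>\<close> is its return in the mixture \<open>\<xi>\<close>, the Bellman argument for the reward
  \<open>- r\<close> yields a deterministic policy \<open>d\<close> of least intelligence. Actions after a late step \<open>m\<close> hardly
  matter, so only the first \<open>m\<close> steps of \<open>d\<close> have to be enforced. The dogmatic environment draws
  percepts uniformly as long as the actions are those of \<open>d\<close>, and its mass vanishes upon the first
  deviation and after step \<open>m\<close>; it has finite support and rational values, hence is lower
  semicomputable. If \<open>\<xi>'\<close> puts almost all its weight on it, deviating from \<open>d\<close> before step \<open>m\<close> forfeits
  almost all return, so every \<open>\<xi>'\<close>-optimal policy agrees with \<open>d\<close> there.\<close>

section \<open>Decidable predicates on tuples of natural numbers\<close>

inductive_cases computes_ZeroE: "computes Zero xs y"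
inductive_cases computes_SuccE: "computes Succ xs y"
inductive_cases computes_ProjE: "computes (Proj i) xs y"
inductive_cases computes_CompE: "computes (Comp f gs) xs y"
inductive_cases computes_PrimRec_0E: "computes (PrimRec f g) (0 # xs) y"
inductive_cases computes_PrimRec_SucE: "computes (PrimRec f g) (Suc n # xs) y"
inductive_cases computes_MinimE: "computes (Minim f) xs n"

text \<open>Only one rule evaluates each program form, once the first argument of
  \<open>PrimRec\<close> is known to be \<open>0\<close> or a successor, so inversion matches the
  two derivations. For \<open>Minim\<close>, the smaller of two different results would be an
  argument with both a zero and a positive value.\<close>

lemma computes_functional: "computes f xs y \<Longrightarrow> computes f xs z \<Longrightarrow> y = z"
proof (induction arbitrary: z rule: computes.induct)
  case (zero xs)
  then show ?case by (rule computes_ZeroE) simp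
next
  case (succ x)
  then show ?case by (rule computes_SuccE) simp
next
  case (proj i xs)
  from proj.prems show ?case by (rule computes_ProjE) simp
next
  case (comp xs gs ys f z z')
  from comp.prems obtain ys' where ys': "list_all2 (\<lambda>g y. computes g xs y) gs ys'" "computes f ys' z'"
    by (rule computes_CompE)
  have "ys = ys'"
  proof (rule nth_equalityI)
    show "length ys = length ys'"
      using comp.IH(1) ys'(1) by (simp add: list_all2_conv_all_nth)
    show "ys ! i = ys' ! i" if "i < length ys" for i
      using comp.IH(1) ys'(1) that unfolding list_all2_conv_all_nth by metis
  qed
  with ys'(2) have "computes f ys z'" by simp
  then show ?case by (rule comp.IH(2))
next
  case (prec_0 f xs y g)
  from prec_0.prems show ?case by (rule computes_PrimRec_0E) (rule prec_0.IH)
next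
  case (prec_Suc f g n xs y z z')
  from prec_Suc.prems obtain y' where y': "computes (PrimRec f g) (n # xs) y'" "computes g (n # y' # xs) z'"
    by (rule computes_PrimRec_SucE)
  from prec_Suc.IH(1)[OF y'(1)] y'(2) show ?case by (intro prec_Suc.IH(2)) simp
next
  case (minim f n xs)
  from minim.prems have z: "computes f (z # xs) 0" "\<forall>m<z. \<exists>y>0. computes f (m # xs) y"
    by (auto elim: computes_MinimE)
  show ?case
  proof (rule linorder_cases[of n z])
    assume "n < z"
    then obtain y where "0 < y" "computes f (n # xs) y" using z(2) by blast
    then show ?thesis using minim.IH(1)[of y] by simp
  next
    assume "z < n"
    then obtain y where "0 < y" "\<And>u. computes f (z # xs) u \<Longrightarrow> y = u" using minim.IH(2) by blast
    then show ?thesis using z(1) by blast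
  qed
qed

section \<open>Total recursive functions, decidable predicates and their closure properties\<close>

definition total_recursive :: "nat \<Rightarrow> (nat list \<Rightarrow> nat) \<Rightarrow> bool" where
  "total_recursive k F \<longleftrightarrow> (\<exists>f. \<forall>xs. length xs = k \<longrightarrow> computes f xs (F xs))"

definition decidable :: "nat \<Rightarrow> (nat list \<Rightarrow> bool) \<Rightarrow> bool" where
  "decidable k P \<longleftrightarrow> total_recursive k (\<lambda>xs. of_bool (P xs))"

named_theorems recursive_intros

lemma total_recursive_cong:
  assumes "total_recursive k F" and "\<And>xs. length xs = k \<Longrightarrow> F xs = G xs"
  shows "total_recursive k G"
  using assms unfolding total_recursive_def by metis

lemma decidable_cong:
  assumes "decidable k P" and "\<And>xs. length xs = k \<Longrightarrow> P xs = Q xs"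
  shows "decidable k Q"
  using assms unfolding decidable_def by (auto elim: total_recursive_cong)

lemma total_recursive_nth [recursive_intros]: "i < k \<Longrightarrow> total_recursive k (\<lambda>xs. xs ! i)"
  unfolding total_recursive_def by (auto intro: computes.proj)

lemma total_recursive_hd [recursive_intros]: "0 < k \<Longrightarrow> total_recursive k hd"
  by (rule total_recursive_cong[OF total_recursive_nth[of 0]]) (auto simp: hd_conv_nth)

lemma total_recursive_compose:
  assumes "total_recursive (length Gs) F" and "\<And>G. G \<in> set Gs \<Longrightarrow> total_recursive k G"
  shows "total_recursive k (\<lambda>xs. F (map (\<lambda>G. G xs) Gs))"
proof -
  obtain f where f: "\<And>xs. length xs = length Gs \<Longrightarrow> computes f xs (F xs)"
    using assms(1) unfolding total_recursive_def by auto
  have "\<forall>G\<in>set Gs. \<exists>g. \<forall>xs. length xs = k \<longrightarrow> computes g xs (G xs)"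
    using assms(2) unfolding total_recursive_def by auto
  then obtain g where "\<And>G xs. G \<in> set Gs \<Longrightarrow> length xs = k \<Longrightarrow> computes (g G) xs (G xs)"
    by metis
  then have "computes (Comp f (map g Gs)) xs (F (map (\<lambda>G. G xs) Gs))" if "length xs = k" for xs
    using that by (intro computes.comp[where ys = "map (\<lambda>G. G xs) Gs"] f) (auto simp: list_all2_conv_all_nth)
  then show ?thesis unfolding total_recursive_def by blast
qed

lemma total_recursive_unary:
  assumes "total_recursive 1 (\<lambda>xs. f (hd xs))" and "total_recursive k A"
  shows "total_recursive k (\<lambda>xs. f (A xs))"
  using total_recursive_compose[of "[A]" "\<lambda>xs. f (hd xs)" k] assms by simp

text \<open>The tail is the tuple of the projections \<open>1\<close> to \<open>k\<close>, with
  which \<open>A\<close> is composed. This makes room for a leading argument, such as a search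
  variable.\<close>

lemma total_recursive_tl [recursive_intros]:
  assumes "total_recursive k A"
  shows "total_recursive (Suc k) (\<lambda>ys. A (tl ys))"
proof (rule total_recursive_cong)
  show "total_recursive (Suc k) (\<lambda>ys. A (map (\<lambda>G. G ys) (map (\<lambda>i ys. ys ! Suc i) [0..<k])))"
    using assms by (intro total_recursive_compose) (auto intro: total_recursive_nth)
  show "A (map (\<lambda>G. G ys) (map (\<lambda>i ys. ys ! Suc i) [0..<k])) = A (tl ys)" if "length ys = Suc k" for ys
    using that by (intro arg_cong[of _ _ A]) (auto intro!: nth_equalityI simp: nth_tl)
qed

lemma total_recursive_Suc [recursive_intros]:
  assumes "total_recursive k A"
  shows "total_recursive k (\<lambda>xs. Suc (A xs))"
proof (rule total_recursive_unary[OF _ assms])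
  have "computes Succ xs (Suc (hd xs))" if "length xs = 1" for xs
    using that by (auto simp: length_Suc_conv intro: computes.succ)
  then show "total_recursive 1 (\<lambda>xs. Suc (hd xs))" unfolding total_recursive_def by blast
qed

lemma total_recursive_const [recursive_intros]: "total_recursive k (\<lambda>xs. c)"
proof (induction c)
  case 0
  show ?case unfolding total_recursive_def by (auto intro: computes.zero)
qed (rule total_recursive_Suc)

text \<open>\<open>S\<close> takes counter, previous value and parameters in the order in which the
  rules for \<open>PrimRec\<close> pass them. Composition with \<open>N\<close> followed by all
  projections lets the recursion depth depend on the parameters.\<close>

lemma total_recursive_rec_nat:
  assumes N: "total_recursive k N" and Z: "total_recursive k Z"
    and S: "total_recursive (Suc (Suc k)) (\<lambda>ys. S (ys ! 0) (ys ! 1) (tl (tl ys)))"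
  shows "total_recursive k (\<lambda>xs. rec_nat (Z xs) (\<lambda>n y. S n y xs) (N xs))"
proof -
  obtain n where n: "\<And>xs. length xs = k \<Longrightarrow> computes n xs (N xs)"
    using N unfolding total_recursive_def by blast
  obtain z where z: "\<And>xs. length xs = k \<Longrightarrow> computes z xs (Z xs)"
    using Z unfolding total_recursive_def by blast
  obtain s where s: "\<And>ys. length ys = Suc (Suc k) \<Longrightarrow> computes s ys (S (ys ! 0) (ys ! 1) (tl (tl ys)))"
    using S unfolding total_recursive_def by blast
  have rec: "computes (PrimRec z s) (i # xs) (rec_nat (Z xs) (\<lambda>n y. S n y xs) i)"
    if "length xs = k" for i xs
  proof (induction i)
    case (Suc i)
    then show ?case
      using s[of "i # rec_nat (Z xs) (\<lambda>n y. S n y xs) i # xs"] that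
      by (auto intro: computes.prec_Suc)
  qed (auto intro: computes.prec_0 z that)
  have "computes (Comp (PrimRec z s) (n # map Proj [0..<k])) xs
          (rec_nat (Z xs) (\<lambda>n y. S n y xs) (N xs))" if "length xs = k" for xs
    using that
    by (intro computes.comp[where ys = "N xs # xs"] rec)
      (auto simp: list_all2_conv_all_nth n nth_Cons split: nat.split intro: computes.proj)
  then show ?thesis unfolding total_recursive_def by blast
qed

lemma total_recursive_add [recursive_intros]:
  assumes "total_recursive k A" and "total_recursive k B"
  shows "total_recursive k (\<lambda>xs. A xs + B xs)"
proof -
  have "rec_nat b (\<lambda>n y. Suc y) a = a + b" for a b by (induction a) auto
  then show ?thesis
    using total_recursive_rec_nat[OF assms, of "\<lambda>n y xs. Suc y"] by (simp add: recursive_intros)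
qed

lemma total_recursive_mult [recursive_intros]:
  assumes "total_recursive k A" and "total_recursive k B"
  shows "total_recursive k (\<lambda>xs. A xs * B xs)"
proof -
  have "rec_nat 0 (\<lambda>n y. y + b) a = a * b" for a b :: nat by (induction a) auto
  moreover have "total_recursive (Suc (Suc k)) (\<lambda>ys. ys ! 1 + B (tl (tl ys)))"
    by (intro recursive_intros total_recursive_tl[of "Suc k" "\<lambda>zs. B (tl zs)"] assms) simp
  ultimately show ?thesis
    using total_recursive_rec_nat[OF assms(1) total_recursive_const[of k 0], of "\<lambda>n y xs. y + B xs"]
    by simp
qed

lemma total_recursive_pred:
  assumes "total_recursive k A"
  shows "total_recursive k (\<lambda>xs. A xs - 1)"
proof -
  have "rec_nat 0 (\<lambda>n y. n) a = a - 1" for a :: nat by (induction a) auto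
  then show ?thesis
    using total_recursive_rec_nat[OF assms(1) total_recursive_const[of k 0], of "\<lambda>n y xs. n"]
    by (simp add: recursive_intros)
qed

lemma total_recursive_diff [recursive_intros]:
  assumes "total_recursive k A" and "total_recursive k B"
  shows "total_recursive k (\<lambda>xs. A xs - B xs)"
proof -
  have "rec_nat a (\<lambda>n y. y - 1) b = a - b" for a b :: nat by (induction b) auto
  then show ?thesis
    using total_recursive_rec_nat[OF assms(2,1), of "\<lambda>n y xs. y - 1"]
    by (simp add: recursive_intros total_recursive_pred del: One_nat_def)
qed

lemma decidable_less [recursive_intros]:
  assumes "total_recursive k A" and "total_recursive k B"
  shows "decidable k (\<lambda>xs. A xs < B xs)"
proof -
  \<comment> \<open>Truncated subtraction: \<open>Suc a - b\<close> vanishes exactly for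
    \<open>a < b\<close>.\<close>
  have "1 - (Suc a - b) = of_bool (a < b)" for a b :: nat by auto
  then show ?thesis
    unfolding decidable_def
    using total_recursive_diff[OF total_recursive_const[of k 1]
        total_recursive_diff[OF total_recursive_Suc[OF assms(1)] assms(2)]] by presburger
qed

lemma decidable_not [recursive_intros]:
  assumes "decidable k P"
  shows "decidable k (\<lambda>xs. \<not> P xs)"
  using total_recursive_diff[OF total_recursive_const[of k 1] assms[unfolded decidable_def]]
  unfolding decidable_def by (rule total_recursive_cong) auto

lemma decidable_conj [recursive_intros]:
  assumes "decidable k P" and "decidable k Q"
  shows "decidable k (\<lambda>xs. P xs \<and> Q xs)"
  using total_recursive_mult[OF assms[unfolded decidable_def]]
  unfolding decidable_def by (rule total_recursive_cong) auto

lemma decidable_disj [recursive_intros]: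
  assumes "decidable k P" and "decidable k Q"
  shows "decidable k (\<lambda>xs. P xs \<or> Q xs)"
  by (rule decidable_cong[OF decidable_not[OF decidable_conj[OF assms[THEN decidable_not]]]]) auto

lemma decidable_eq [recursive_intros]:
  assumes "total_recursive k A" and "total_recursive k B"
  shows "decidable k (\<lambda>xs. A xs = B xs)"
  by (rule decidable_cong[of _ "\<lambda>xs. \<not> A xs < B xs \<and> \<not> B xs < A xs"])
    (auto intro!: recursive_intros assms)

lemma decidable_finite_ex [recursive_intros]:
  assumes "finite I" and "\<And>i. i \<in> I \<Longrightarrow> decidable k (P i)"
  shows "decidable k (\<lambda>xs. \<exists>i\<in>I. P i xs)"
  using assms
proof (induction I)
  case empty
  show ?case using decidable_less[OF total_recursive_const[of k 0] total_recursive_const[of k 0]] by simp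
next
  case (insert i I)
  then show ?case using decidable_disj[of k "P i" "\<lambda>xs. \<exists>i\<in>I. P i xs"] by simp
qed

text \<open>Primitive recursion accumulates the disjunction as a truth value \<open>0\<close> or
  \<open>1\<close>.\<close>

lemma decidable_bounded_ex [recursive_intros]:
  assumes B: "total_recursive k B" and P: "decidable (Suc k) (\<lambda>ys. P (hd ys) (tl ys))"
  shows "decidable k (\<lambda>xs. \<exists>i<B xs. P i xs)"
proof -
  have eq: "rec_nat 0 (\<lambda>n y. of_bool (P n xs \<or> 0 < y)) b = (of_bool (\<exists>i<b. P i xs) :: nat)" for xs b
    by (induction b) (auto simp: less_Suc_eq)
  have "total_recursive (Suc (Suc k)) (\<lambda>ys. of_bool (P (ys ! 0) (tl (tl ys)) \<or> 0 < ys ! 1))"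
    unfolding decidable_def[symmetric]
  proof (intro recursive_intros)
    \<comment> \<open>The recursion step sees \<open>i # y # xs\<close>; the projections skip the
      accumulator \<open>y\<close> before \<open>P\<close> is applied.\<close>
    have "total_recursive (Suc (Suc k)) (\<lambda>ys. (\<lambda>zs. of_bool (P (hd zs) (tl zs)))
        (map (\<lambda>G. G ys) ((\<lambda>ys. ys ! 0) # map (\<lambda>i ys. ys ! Suc (Suc i)) [0..<k])))"
      using P unfolding decidable_def
      by (intro total_recursive_compose) (auto intro: total_recursive_nth)
    then show "decidable (Suc (Suc k)) (\<lambda>ys. P (ys ! 0) (tl (tl ys)))"
      unfolding decidable_def
    proof (rule total_recursive_cong)
      fix ys :: "nat list"
      assume "length ys = Suc (Suc k)"
      then have "map (\<lambda>i. ys ! Suc (Suc i)) [0..<k] = tl (tl ys)"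
        by (auto intro!: nth_equalityI simp: nth_tl)
      then show "(\<lambda>zs. of_bool (P (hd zs) (tl zs)))
          (map (\<lambda>G. G ys) ((\<lambda>ys. ys ! 0) # map (\<lambda>i ys. ys ! Suc (Suc i)) [0..<k]))
        = (of_bool (P (ys ! 0) (tl (tl ys))) :: nat)"
        by (simp add: comp_def)
    qed
  qed auto
  from total_recursive_rec_nat[OF B total_recursive_const[of k 0] this] show ?thesis
    unfolding decidable_def eq .
qed

text \<open>Minimisation finds the value, as the graph is decidable and has one at every argument.
  The program decides the negation because \<open>Minim\<close> looks for a zero.\<close>

lemma total_recursive_graph:
  assumes P: "decidable (Suc k) (\<lambda>ys. P (hd ys) (tl ys))"
    and graph: "\<And>i xs. length xs = k \<Longrightarrow> P i xs \<longleftrightarrow> i = U xs"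
  shows "total_recursive k U"
proof -
  obtain f where f: "\<And>ys. length ys = Suc k \<Longrightarrow> computes f ys (of_bool (\<not> P (hd ys) (tl ys)))"
    using decidable_not[OF P] unfolding decidable_def total_recursive_def by blast
  have "computes (Minim f) xs (U xs)" if len: "length xs = k" for xs
  proof (rule computes.minim)
    show "computes f (U xs # xs) 0" using f[of "U xs # xs"] graph[OF len] len by simp
    show "\<forall>m<U xs. \<exists>y>0. computes f (m # xs) y"
    proof (intro allI impI)
      fix m assume "m < U xs"
      then show "\<exists>y>0. computes f (m # xs) y"
        using f[of "m # xs"] graph[OF len] len by (intro exI[of _ 1]) simp
    qed
  qed
  then show ?thesis unfolding total_recursive_def by blast
qed

text \<open>Minimisation over a dummy first argument halts at once if \<open>P n\<close> holds and
  never otherwise.\<close>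

lemma recursively_enumerable_if_decidable:
  assumes "decidable 1 (\<lambda>xs. P (hd xs))"
  shows "recursively_enumerable {n. P n}"
proof -
  obtain f where f: "\<And>ys. length ys = 2 \<Longrightarrow> computes f ys (of_bool (\<not> P (hd (tl ys))))"
    using total_recursive_tl[OF decidable_not[OF assms, unfolded decidable_def]]
    unfolding total_recursive_def by (auto simp: numeral_2_eq_2)
  have "P n \<longleftrightarrow> (\<exists>y. computes (Minim f) [n] y)" for n
  proof
    assume "P n"
    then show "\<exists>y. computes (Minim f) [n] y"
      using f[of "[0, n]"] by (intro exI[of _ 0] computes.minim) auto
  next
    assume "\<exists>y. computes (Minim f) [n] y"
    then obtain y where "computes f [y, n] 0" by (auto elim: computes_MinimE)
    then show "P n" using f[of "[y, n]"] computes_functional by fastforce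
  qed
  then show ?thesis unfolding recursively_enumerable_def by blast
qed

lemma decidable_even [recursive_intros]:
  assumes "total_recursive k A"
  shows "decidable k (\<lambda>xs. even (A xs))"
proof -
  have "decidable k (\<lambda>xs. \<exists>j<Suc (A xs). A xs = 2 * j)"
    by (intro recursive_intros assms) auto
  then show ?thesis by (rule decidable_cong) (auto elim!: evenE)
qed

lemma total_recursive_div2 [recursive_intros]:
  assumes "total_recursive k A"
  shows "total_recursive k (\<lambda>xs. A xs div 2)"
proof (rule total_recursive_graph)
  show "decidable (Suc k) (\<lambda>ys. 2 * hd ys = A (tl ys) \<or> Suc (2 * hd ys) = A (tl ys))"
    by (intro recursive_intros assms) auto
qed auto

section \<open>Codes of pairs, lists and histories\<close>

lemma total_recursive_prod_encode [recursive_intros]: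
  assumes "total_recursive k A" and "total_recursive k B"
  shows "total_recursive k (\<lambda>xs. prod_encode (A xs, B xs))"
  unfolding prod_encode_def triangle_def by (auto intro!: recursive_intros assms)

text \<open>The second component of a pair is at most its code, so a bounded search for it decides
  the graph of the first.\<close>

lemma total_recursive_fst_prod_decode [recursive_intros]:
  assumes "total_recursive k A"
  shows "total_recursive k (\<lambda>xs. fst (prod_decode (A xs)))"
proof (rule total_recursive_graph)
  show "decidable (Suc k) (\<lambda>ys. \<exists>b<Suc (A (tl ys)). A (tl ys) = prod_encode (hd ys, b))"
    by (intro recursive_intros assms total_recursive_tl[of "Suc k" hd]) auto
next
  fix i and xs :: "nat list"
  show "(\<exists>b<Suc (A xs). A xs = prod_encode (i, b)) \<longleftrightarrow> i = fst (prod_decode (A xs))"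
    by (metis fst_conv le_imp_less_Suc le_prod_encode_2 prod.collapse prod_decode_inverse prod_encode_inverse)
qed

lemma total_recursive_snd_prod_decode [recursive_intros]:
  assumes "total_recursive k A"
  shows "total_recursive k (\<lambda>xs. snd (prod_decode (A xs)))"
proof (rule total_recursive_graph)
  show "decidable (Suc k) (\<lambda>ys. A (tl ys) = prod_encode (fst (prod_decode (A (tl ys))), hd ys))"
    by (intro recursive_intros assms) auto
next
  fix i and xs :: "nat list"
  show "(A xs = prod_encode (fst (prod_decode (A xs)), i)) \<longleftrightarrow> i = snd (prod_decode (A xs))"
    by (metis prod.collapse prod_decode_inverse prod_encode_inverse snd_conv)
qed

text \<open>This turns a quantifier over the positions of a list into one bounded by its
  code.\<close>

lemma length_le_list_encode: "length xs \<le> list_encode xs"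
proof (induction xs)
  case (Cons x xs)
  then show ?case using le_prod_encode_2[of "list_encode xs" x] by simp
qed simp

text \<open>The code of \<open>x # xs\<close> is the successor of a pair code. The empty list has
  code \<open>0\<close>, which truncated subtraction and decoding leave at \<open>0\<close>.\<close>

lemma list_encode_tl: "snd (prod_decode (list_encode xs - 1)) = list_encode (tl xs)"
proof (cases xs)
  case Nil
  have "prod_decode 0 = (0, 0)" by (simp add: prod_decode_def prod_decode_aux.simps)
  with Nil show ?thesis by simp
qed simp

lemma decidable_set_list_decode_subset [recursive_intros]:
  assumes R: "finite R" and A: "total_recursive k A"
  shows "decidable k (\<lambda>xs. set (list_decode (A xs)) \<subseteq> R)"
proof -
  \<comment> \<open>Iterated tails: \<open>T n i\<close> codes the list without its first
    \<open>i\<close> entries. It is nonzero exactly if position \<open>i\<close> exists, and then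
    the first component of its predecessor is the entry there.\<close>
  define T where "T n i = rec_nat n (\<lambda>_ y. snd (prod_decode (y - 1))) i" for n i :: nat
  have T: "T n i = list_encode (drop i (list_decode n))" for n i
    by (induction i) (simp_all add: T_def list_encode_tl[simplified] drop_Suc drop_tl)
  have T_rec: "total_recursive (Suc k) (\<lambda>ys. T (A (tl ys)) (hd ys))"
    unfolding T_def
    by (rule total_recursive_rec_nat) (intro recursive_intros A; simp)+
  have "decidable k (\<lambda>xs. \<not> (\<exists>i<A xs. 0 < T (A xs) i \<and>
          \<not> (\<exists>j\<in>R. fst (prod_decode (T (A xs) i - 1)) = j)))"
    by (intro recursive_intros A R T_rec)
  moreover have "set (list_decode n) \<subseteq> R \<longleftrightarrow>
      \<not> (\<exists>i<n. 0 < T n i \<and> \<not> (\<exists>j\<in>R. fst (prod_decode (T n i - 1)) = j))" for n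
  proof -
    define xs where "xs = list_decode n"
    have n: "n = list_encode xs" by (simp add: xs_def)
    have drop: "T n i = list_encode (drop i xs)" for i by (simp add: T xs_def)
    have pos: "0 < T n i \<longleftrightarrow> i < length xs" for i
      unfolding drop by (cases "i < length xs") (simp_all add: Cons_nth_drop_Suc[symmetric])
    have hd: "fst (prod_decode (T n i - 1)) = xs ! i" if "i < length xs" for i
      unfolding drop using that by (simp add: Cons_nth_drop_Suc[symmetric])
    have "length xs \<le> n" using length_le_list_encode[of xs] n by simp
    then show ?thesis
      using pos hd unfolding xs_def[symmetric] by (auto simp: subset_iff in_set_conv_nth)
  qed
  ultimately show ?thesis by simp
qed

text \<open>Codes of histories are recognised by checking the entries against a finite set.\<close>

lemma history_encode_range:
  "n \<in> range (history_encode :: ('a::finite, 'e::finite) history \<Rightarrow> nat) \<longleftrightarrow>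
     set (list_decode n) \<subseteq> range (to_nat :: 'a \<times> 'e \<Rightarrow> nat)"
proof
  assume "set (list_decode n) \<subseteq> range (to_nat :: 'a \<times> 'e \<Rightarrow> nat)"
  then have "list_decode n \<in> lists (range (to_nat :: 'a \<times> 'e \<Rightarrow> nat))" by auto
  then obtain h :: "('a, 'e) history" where "list_decode n = map to_nat h"
    unfolding lists_image by auto
  then have "n = history_encode h" unfolding history_encode_def by (metis list_decode_inverse)
  then show "n \<in> range (history_encode :: ('a, 'e) history \<Rightarrow> nat)" by blast
qed (auto simp: history_encode_def)

lemma history_encode_inject: "history_encode g = history_encode h \<longleftrightarrow> g = h"
  by (auto simp: history_encode_def list_encode_eq dest: map_injective)

lemma int_encode_odd_iff: "odd (int_encode p) \<longleftrightarrow> p < 0"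
  by (auto simp: int_encode_def sum_encode_def)

lemma int_encode_div2: "0 \<le> p \<Longrightarrow> int (int_encode p div 2) = p"
  by (auto simp: int_encode_def sum_encode_def)

text \<open>The finite table of values is built into a decision procedure. A negative rational lies
  below every value; a nonnegative one can do so only on the support, where fractions are compared
  by cross-multiplication.\<close>

lemma lower_semicomputable_finite_support:
  fixes f :: "('a::finite, 'e::finite) history \<Rightarrow> real"
  assumes F: "finite F" and supp: "\<And>h. h \<notin> F \<Longrightarrow> f h = 0"
    and nonneg: "\<And>h. 0 \<le> f h" and rat: "\<And>h. f h \<in> \<rat>"
  shows "lower_semicomputable history_encode f"
proof -
  have "\<exists>u v :: nat. 0 < v \<and> f h = real u / real v" for h
    using rat[of h] nonneg[of h] by (metis Rats_abs_nat_div_natE abs_of_nonneg neq0_conv)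
  then obtain u v :: "('a, 'e) history \<Rightarrow> nat" where v: "\<And>h. 0 < v h"
    and f: "\<And>h. f h = real (u h) / real (v h)"
    by metis
  let ?R = "range (to_nat :: 'a \<times> 'e \<Rightarrow> nat)"
  \<comment> \<open>\<open>a\<close>, \<open>b\<close>, \<open>d\<close> stand for history,
    numerator and denominator; an odd \<open>b\<close> codes a negative numerator, an even one the
    numerator \<open>b div 2\<close>.\<close>
  define P where "P n \<longleftrightarrow> (let a = fst (prod_decode n); b = fst (prod_decode (snd (prod_decode n)));
      d = snd (prod_decode (snd (prod_decode n))) in
      set (list_decode a) \<subseteq> ?R \<and> 0 < d \<and>
      (\<not> even b \<or> (\<exists>h\<in>F. a = history_encode h \<and> (b div 2) * v h < u h * d)))" for n
  have "decidable 1 (\<lambda>xs. P (hd xs))"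
    unfolding P_def Let_def by (intro recursive_intros F) auto
  moreover have "{prod_encode (history_encode h, prod_encode (int_encode p, d)) | h p d.
        d > 0 \<and> f h > real_of_int p / real d} = {n. P n}"
  proof -
    have key: "f h > real_of_int p / real d \<longleftrightarrow> p < 0 \<or> h \<in> F \<and> (int_encode p div 2) * v h < u h * d"
      if d: "d > 0" for h p d
    proof (cases "p < 0")
      case True
      then have "real_of_int p / real d < 0" using d by (simp add: divide_neg_pos)
      with nonneg[of h] True show ?thesis by linarith
    next
      case False
      define q where "q = int_encode p div 2"
      have p: "real_of_int p = real q" using int_encode_div2[of p] False unfolding q_def by (metis not_less of_int_of_nat_eq)
      have "f h > real_of_int p / real d \<longleftrightarrow> q * v h < u h * d"
        using d v[of h] unfolding f p by (simp add: divide_simps mult.commute of_nat_mult[symmetric] del: of_nat_mult)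
      moreover have "h \<in> F" if "q * v h < u h * d"
        using supp[of h] that v[of h] d by (cases "h \<in> F") (auto simp: f)
      ultimately show ?thesis using False unfolding q_def by blast
    qed
    have P_enc: "P (prod_encode (history_encode h, prod_encode (int_encode p, d))) \<longleftrightarrow>
        d > 0 \<and> f h > real_of_int p / real d" for h p d
    proof -
      have "set (list_decode (history_encode h)) \<subseteq> ?R"
        using history_encode_range by blast
      then show ?thesis
        unfolding P_def Let_def using key[of d p h]
        by (auto simp: history_encode_inject int_encode_odd_iff)
    qed
    \<comment> \<open>Every natural number codes an integer, so only the history component restricts
      the shape of \<open>n\<close>.\<close>
    have "\<exists>(h :: ('a, 'e) history) p d. n = prod_encode (history_encode h, prod_encode (int_encode p, d))" if "P n"
      for n
    proof -
      have "fst (prod_decode n) \<in> range (history_encode :: ('a, 'e) history \<Rightarrow> nat)"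
        using that unfolding P_def Let_def history_encode_range by blast
      then obtain h :: "('a, 'e) history" where "fst (prod_decode n) = history_encode h" by blast
      then have "n = prod_encode (history_encode h, prod_encode
          (int_encode (int_decode (fst (prod_decode (snd (prod_decode n))))), snd (prod_decode (snd (prod_decode n)))))"
        by (metis int_decode_inverse prod.collapse prod_decode_inverse)
      then show ?thesis by blast
    qed
    then show ?thesis using P_enc by blast
  qed
  ultimately show ?thesis
    unfolding lower_semicomputable_def by (simp add: recursively_enumerable_if_decidable)
qed

section \<open>Returns of a policy and the Bellman equation\<close>

definition step_return ::
  "('e::finite \<Rightarrow> real) \<Rightarrow> ('a::finite, 'e) env \<Rightarrow> ('a, 'e) policy \<Rightarrow> nat \<Rightarrow> ('a, 'e) history \<Rightarrow> real" where
  "step_return r \<mu> \<pi> n h =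
     (\<Sum>g | length g = Suc n. r (snd (last g)) * \<mu> (h @ g) * policy_prob \<pi> h g)"

text \<open>Without division by the discount tail, which changes from step to step, the Bellman
  equation has no denominators.\<close>

definition raw_return ::
  "(nat \<Rightarrow> real) \<Rightarrow> ('e::finite \<Rightarrow> real) \<Rightarrow> ('a::finite, 'e) env \<Rightarrow> ('a, 'e) policy
     \<Rightarrow> ('a, 'e) history \<Rightarrow> real" where
  "raw_return \<gamma> r \<mu> \<pi> h = (\<Sum>n. \<gamma> (Suc (length h) + n) * step_return r \<mu> \<pi> n h)"

lemma expected_return_eq_raw_return:
  "expected_return \<gamma> r \<mu> \<pi> h = (if discount_tail \<gamma> (Suc (length h)) > 0
     then raw_return \<gamma> r \<mu> \<pi> h / discount_tail \<gamma> (Suc (length h)) else 0)"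
  by (simp add: expected_return_def raw_return_def step_return_def)

lemma policy_prob_Cons:
  "policy_prob \<pi> h (x # g) = pmf (\<pi> h) (fst x) * policy_prob \<pi> (h @ [x]) g"
  by (simp add: policy_prob_def prod.lessThan_Suc_shift del: prod.lessThan_Suc)

lemma policy_prob_cong:
  assumes "\<And>g'. \<pi> (h @ g') = \<pi>' (h @ g')"
  shows "policy_prob \<pi> h g = policy_prob \<pi>' h g"
  by (simp add: policy_prob_def assms)

text \<open>In particular, altering a policy at a strict prefix of \<open>h\<close> does not affect
  the return after \<open>h\<close>.\<close>

lemma raw_return_cong:
  assumes "\<And>g. \<pi> (h @ g) = \<pi>' (h @ g)"
  shows "raw_return \<gamma> r \<mu> \<pi> h = raw_return \<gamma> r \<mu> \<pi>' h"
  using policy_prob_cong[of \<pi> h \<pi>'] assms by (simp add: raw_return_def step_return_def)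

lemma sum_length_Suc:
  fixes f :: "'x::finite list \<Rightarrow> real"
  shows "(\<Sum>g | length g = Suc n. f g) = (\<Sum>x\<in>UNIV. \<Sum>g | length g = n. f (x # g))"
proof -
  have "{g :: 'x list. length g = Suc n} = (\<lambda>(x, g). x # g) ` (UNIV \<times> {g. length g = n})"
    by (auto simp: length_Suc_conv image_def)
  moreover have "inj_on (\<lambda>(x, g). x # g) (UNIV \<times> {g :: 'x list. length g = n})"
    by (auto simp: inj_on_def)
  ultimately show ?thesis
    by (simp add: sum.reindex sum.cartesian_product case_prod_unfold)
qed

lemma sum_UNIV_prod:
  fixes f :: "'x::finite \<times> 'y::finite \<Rightarrow> real"
  shows "sum f UNIV = (\<Sum>a\<in>UNIV. \<Sum>e\<in>UNIV. f (a, e))"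
  by (simp add: sum.cartesian_product flip: UNIV_Times_UNIV)

lemma step_return_0:
  "step_return r \<mu> \<pi> 0 h = (\<Sum>a\<in>UNIV. pmf (\<pi> h) a * (\<Sum>e\<in>UNIV. r e * \<mu> (h @ [(a, e)])))"
  by (simp add: step_return_def sum_length_Suc sum_UNIV_prod policy_prob_Cons policy_prob_def
      sum_distrib_left mult_ac)

lemma step_return_Suc:
  "step_return r \<mu> \<pi> (Suc n) h =
     (\<Sum>a\<in>UNIV. pmf (\<pi> h) a * (\<Sum>e\<in>UNIV. step_return r \<mu> \<pi> n (h @ [(a, e)])))"
proof -
  have "step_return r \<mu> \<pi> (Suc n) h = (\<Sum>x\<in>UNIV. pmf (\<pi> h) (fst x) * step_return r \<mu> \<pi> n (h @ [x]))"
    unfolding step_return_def sum_length_Suc[of _ "Suc n"] sum_distrib_left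
    by (intro sum.cong refl) (auto simp: policy_prob_Cons mult_ac)
  then show ?thesis by (simp add: sum_UNIV_prod sum_distrib_left)
qed

lemma pmf_average_le:
  fixes f :: "'a::finite \<Rightarrow> real"
  assumes "\<And>a. f a \<le> c"
  shows "(\<Sum>a\<in>UNIV. pmf p a * f a) \<le> c"
proof -
  have "(\<Sum>a\<in>UNIV. pmf p a * f a) \<le> (\<Sum>a\<in>UNIV. pmf p a * c)"
    by (intro sum_mono mult_left_mono assms) simp
  also have "\<dots> = c" by (simp flip: sum_distrib_right add: sum_pmf_eq_1)
  finally show ?thesis .
qed

lemma pmf_average_abs_le:
  fixes f :: "'a::finite \<Rightarrow> real"
  assumes "\<And>a. \<bar>f a\<bar> \<le> c"
  shows "\<bar>\<Sum>a\<in>UNIV. pmf p a * f a\<bar> \<le> c"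
proof -
  have "(\<Sum>a\<in>UNIV. pmf p a * f a) \<le> c" "(\<Sum>a\<in>UNIV. pmf p a * (- f a)) \<le> c"
    using assms by (intro pmf_average_le; simp add: abs_le_iff)+
  then show ?thesis by (simp add: abs_le_iff sum_negf)
qed

lemma chronological_semimeasureD:
  assumes "chronological_semimeasure \<mu>"
  shows "0 \<le> \<mu> h" "\<mu> h \<le> 1" "(\<Sum>e\<in>UNIV. \<mu> (h @ [(a, e)])) \<le> \<mu> h"
  using assms unfolding chronological_semimeasure_def by auto

text \<open>By induction on \<open>n\<close>: the masses of the successors under one action add up
  to at most \<open>\<mu> h\<close>, and averaging over actions keeps the bound.\<close>

lemma step_return_abs_le:
  assumes \<mu>: "chronological_semimeasure \<mu>" and r: "\<And>e. \<bar>r e\<bar> \<le> 1"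
  shows "\<bar>step_return r \<mu> \<pi> n h\<bar> \<le> \<mu> h"
proof (induction n arbitrary: h)
  case 0
  have "\<bar>\<Sum>e\<in>UNIV. r e * \<mu> (h @ [(a, e)])\<bar> \<le> \<mu> h" for a
  proof -
    have "\<bar>\<Sum>e\<in>UNIV. r e * \<mu> (h @ [(a, e)])\<bar> \<le> (\<Sum>e\<in>UNIV. \<mu> (h @ [(a, e)]))"
      using chronological_semimeasureD(1)[OF \<mu>] r
      by (intro order_trans[OF sum_abs] sum_mono) (simp add: abs_mult mult_left_le_one_le)
    with chronological_semimeasureD(3)[OF \<mu>, of h a] show ?thesis by linarith
  qed
  then show ?case unfolding step_return_0 by (rule pmf_average_abs_le)
next
  case (Suc n)
  have "\<bar>\<Sum>e\<in>UNIV. step_return r \<mu> \<pi> n (h @ [(a, e)])\<bar> \<le> \<mu> h" for a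
  proof -
    have "\<bar>\<Sum>e\<in>UNIV. step_return r \<mu> \<pi> n (h @ [(a, e)])\<bar> \<le> (\<Sum>e\<in>UNIV. \<mu> (h @ [(a, e)]))"
      by (intro order_trans[OF sum_abs] sum_mono Suc.IH)
    with chronological_semimeasureD(3)[OF \<mu>, of h a] show ?thesis by linarith
  qed
  then show ?case unfolding step_return_Suc by (rule pmf_average_abs_le)
qed

lemma step_return_nonneg:
  assumes "chronological_semimeasure \<mu>" and "\<And>e. 0 \<le> r e"
  shows "0 \<le> step_return r \<mu> \<pi> n h"
  unfolding step_return_def policy_prob_def
  by (intro sum_nonneg mult_nonneg_nonneg prod_nonneg assms chronological_semimeasureD(1)[OF assms(1)]) simp

section \<open>Discount tails, the Bellman equation and deterministic maximisers\<close>

locale discount =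
  fixes \<gamma> :: "nat \<Rightarrow> real"
  assumes discount_nonneg: "0 \<le> \<gamma> k" and discount_summable: "summable \<gamma>"
begin

lemma summable_discount_shift: "summable (\<lambda>n. \<gamma> (t + n))"
  using discount_summable summable_iff_shift[of \<gamma> t] by (simp add: add.commute)

lemma discount_tail_Suc: "discount_tail \<gamma> t = \<gamma> t + discount_tail \<gamma> (Suc t)"
  using suminf_split_initial_segment[OF summable_discount_shift, of t 1]
  by (simp add: discount_tail_def)

lemma discount_tail_nonneg: "0 \<le> discount_tail \<gamma> t"
  unfolding discount_tail_def by (intro suminf_nonneg summable_discount_shift discount_nonneg)

lemma discount_tail_antimono: "s \<le> t \<Longrightarrow> discount_tail \<gamma> t \<le> discount_tail \<gamma> s"
  by (rule lift_Suc_antimono_le) (metis discount_tail_Suc discount_nonneg le_add_same_cancel2)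

lemma discount_tail_tendsto_0: "(\<lambda>t. discount_tail \<gamma> t) \<longlonglongrightarrow> 0"
  using suminf_exist_split2[OF discount_summable] by (simp add: discount_tail_def add.commute)

end

locale bounded_return = discount \<gamma> for \<gamma> :: "nat \<Rightarrow> real" +
  fixes r :: "'e::finite \<Rightarrow> real" and \<mu> :: "('a::finite, 'e) env"
  assumes \<mu>: "chronological_semimeasure \<mu>" and r: "\<bar>r e\<bar> \<le> 1"
begin

lemma summable_step_return: "summable (\<lambda>n. \<gamma> (t + n) * step_return r \<mu> \<pi> n h)"
proof (rule summable_comparison_test')
  show "summable (\<lambda>n. \<gamma> (t + n) * \<mu> h)" by (intro summable_mult2 summable_discount_shift)
  show "norm (\<gamma> (t + n) * step_return r \<mu> \<pi> n h) \<le> \<gamma> (t + n) * \<mu> h" for n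
    using step_return_abs_le[of \<mu> r \<pi> n h, OF \<mu> r] discount_nonneg[of "t + n"]
    by (simp add: abs_mult mult_left_mono)
qed

lemma raw_return_abs_le: "\<bar>raw_return \<gamma> r \<mu> \<pi> h\<bar> \<le> discount_tail \<gamma> (Suc (length h)) * \<mu> h"
proof -
  let ?t = "Suc (length h)"
  have "\<bar>raw_return \<gamma> r \<mu> \<pi> h\<bar> \<le> (\<Sum>n. \<gamma> (?t + n) * \<mu> h)"
    unfolding raw_return_def abs_le_iff
  proof
    have le: "\<bar>\<gamma> (?t + n) * step_return r \<mu> \<pi> n h\<bar> \<le> \<gamma> (?t + n) * \<mu> h" for n
      using step_return_abs_le[of \<mu> r \<pi> n h, OF \<mu> r] discount_nonneg[of "?t + n"]
      by (simp add: abs_mult mult_left_mono)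
    have sm: "summable (\<lambda>n. \<gamma> (?t + n) * \<mu> h)" by (intro summable_mult2 summable_discount_shift)
    show "(\<Sum>n. \<gamma> (?t + n) * step_return r \<mu> \<pi> n h) \<le> (\<Sum>n. \<gamma> (?t + n) * \<mu> h)"
      using le by (intro suminf_le summable_step_return sm) (simp add: abs_le_iff)
    show "- (\<Sum>n. \<gamma> (?t + n) * step_return r \<mu> \<pi> n h) \<le> (\<Sum>n. \<gamma> (?t + n) * \<mu> h)"
      unfolding suminf_minus[OF summable_step_return, symmetric]
      using le by (intro suminf_le summable_minus summable_step_return sm) (simp add: abs_le_iff)
  qed
  then show ?thesis
    unfolding discount_tail_def suminf_mult2[OF summable_discount_shift] .
qed

text \<open>The first term of the series is the immediate reward; the others are regrouped by the
  first action and percept, of which there are finitely many.\<close>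

lemma raw_return_step:
  "raw_return \<gamma> r \<mu> \<pi> h = (\<Sum>a\<in>UNIV. pmf (\<pi> h) a *
     (\<Sum>e\<in>UNIV. \<gamma> (Suc (length h)) * (r e * \<mu> (h @ [(a, e)])) + raw_return \<gamma> r \<mu> \<pi> (h @ [(a, e)])))"
proof -
  let ?t = "Suc (length h)"
  let ?g = "\<lambda>n a e. \<gamma> (Suc ?t + n) * step_return r \<mu> \<pi> n (h @ [(a, e)])"
  have "raw_return \<gamma> r \<mu> \<pi> h =
      (\<Sum>n. \<gamma> (Suc ?t + n) * step_return r \<mu> \<pi> (Suc n) h) + \<gamma> ?t * step_return r \<mu> \<pi> 0 h"
    using suminf_split_initial_segment[OF summable_step_return[of ?t \<pi> h], of 1]
    by (simp add: raw_return_def)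
  moreover have "(\<Sum>n. \<gamma> (Suc ?t + n) * step_return r \<mu> \<pi> (Suc n) h)
      = (\<Sum>a\<in>UNIV. pmf (\<pi> h) a * (\<Sum>e\<in>UNIV. raw_return \<gamma> r \<mu> \<pi> (h @ [(a, e)])))"
  proof -
    have sm: "summable (\<lambda>n. ?g n a e)" for a e by (rule summable_step_return)
    have "(\<lambda>n. \<Sum>a\<in>UNIV. pmf (\<pi> h) a * (\<Sum>e\<in>UNIV. ?g n a e))
        sums (\<Sum>a\<in>UNIV. pmf (\<pi> h) a * (\<Sum>e\<in>UNIV. \<Sum>n. ?g n a e))"
      by (intro sums_sum sums_mult summable_sums sm)
    then show ?thesis
      by (simp add: sums_iff step_return_Suc raw_return_def sum_distrib_left mult_ac)
  qed
  ultimately show ?thesis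
    by (simp add: step_return_0 sum.distrib sum_distrib_left algebra_simps)
qed

lemma raw_return_step_return_pmf:
  assumes "\<pi> h = return_pmf a"
  shows "raw_return \<gamma> r \<mu> \<pi> h =
     (\<Sum>e\<in>UNIV. \<gamma> (Suc (length h)) * (r e * \<mu> (h @ [(a, e)])) + raw_return \<gamma> r \<mu> \<pi> (h @ [(a, e)]))"
proof -
  have "(\<Sum>b\<in>UNIV. pmf (\<pi> h) b * f b) = f a" for f :: "'a \<Rightarrow> real"
    unfolding assms by (simp add: pmf_return indicator_def if_distrib[of "\<lambda>x. x * _"] sum.delta cong: if_cong)
  then show ?thesis by (subst raw_return_step) simp
qed

text \<open>Acting greedily with respect to the supremum of all returns loses nothing: the loss at a history is
  bounded by the total loss one step later, hence by arbitrarily late discount tails.\<close>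

lemma exists_deterministic_optimal:
  "\<exists>d. \<forall>h \<pi>. raw_return \<gamma> r \<mu> \<pi> h \<le> raw_return \<gamma> r \<mu> (\<lambda>h. return_pmf (d h)) h"
proof -
  let ?W = "raw_return \<gamma> r \<mu>"
  define S where "S h = (SUP \<pi>. ?W \<pi> h)" for h
  have bdd: "bdd_above (range (\<lambda>\<pi>. ?W \<pi> h))" for h
    using raw_return_abs_le[of _ h] by (intro bdd_aboveI2[where M = "discount_tail \<gamma> (Suc (length h)) * \<mu> h"]) (auto dest: abs_le_D1)
  have le_S: "?W \<pi> h \<le> S h" for \<pi> h
    unfolding S_def by (intro cSUP_upper bdd) auto
  have S_le: "S h \<le> discount_tail \<gamma> (Suc (length h)) * \<mu> h" for h
    unfolding S_def using raw_return_abs_le by (intro cSUP_least) (auto dest: abs_le_D1)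
  \<comment> \<open>The value of playing \<open>a\<close> and attaining the supremum from the next
    step on; \<open>d\<close> will maximise it over the finite action set.\<close>
  define Q where "Q h a = (\<Sum>e\<in>UNIV. \<gamma> (Suc (length h)) * (r e * \<mu> (h @ [(a, e)])) + S (h @ [(a, e)]))" for h a
  have "\<exists>a. \<forall>b. Q h b \<le> Q h a" for h
  proof -
    have "Max (range (Q h)) \<in> range (Q h)" by (rule Max_in) auto
    then obtain a where "Max (range (Q h)) = Q h a" by blast
    then have "\<forall>b. Q h b \<le> Q h a" by (metis Max_ge finite_class.finite_UNIV finite_imageI rangeI)
    then show ?thesis ..
  qed
  then obtain d where d: "\<And>h b. Q h b \<le> Q h (d h)" by metis
  let ?\<pi> = "\<lambda>h. return_pmf (d h)"
  have S_Q: "S h \<le> Q h (d h)" for h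
    unfolding S_def
  proof (rule cSUP_least)
    fix \<pi>
    have "(\<Sum>e\<in>UNIV. \<gamma> (Suc (length h)) * (r e * \<mu> (h @ [(a, e)])) + ?W \<pi> (h @ [(a, e)])) \<le> Q h a" for a
      unfolding Q_def by (intro sum_mono add_mono le_S order_refl)
    then show "?W \<pi> h \<le> Q h (d h)"
      by (subst raw_return_step) (intro pmf_average_le order_trans[OF _ d])
  qed simp
  \<comment> \<open>The factor \<open>2\<close> collects the upper bound on \<open>S h\<close> and
    the lower bound on the return. Each unrolling moves the loss one step later, where the masses
    add up to at most \<open>\<mu> h\<close>.\<close>
  have "S h - ?W ?\<pi> h \<le> 2 * discount_tail \<gamma> (Suc (length h) + n) * \<mu> h" for n h
  proof (induction n arbitrary: h)
    case 0
    show ?case using S_le[of h] raw_return_abs_le[of ?\<pi> h] by (auto dest: abs_le_D2)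
  next
    case (Suc n)
    let ?c = "2 * discount_tail \<gamma> (Suc (length h) + Suc n)"
    have "S h - ?W ?\<pi> h \<le> Q h (d h) - ?W ?\<pi> h" using S_Q by simp
    also have "\<dots> = (\<Sum>e\<in>UNIV. S (h @ [(d h, e)]) - ?W ?\<pi> (h @ [(d h, e)]))"
      by (subst raw_return_step_return_pmf[of ?\<pi> h "d h"]) (simp_all add: Q_def sum.distrib sum_subtractf)
    also have "\<dots> \<le> (\<Sum>e\<in>UNIV. ?c * \<mu> (h @ [(d h, e)]))"
      using Suc.IH[of "h @ [(d h, _)]"] by (intro sum_mono) simp
    also have "\<dots> \<le> ?c * \<mu> h"
      unfolding sum_distrib_left[symmetric]
      by (intro mult_left_mono chronological_semimeasureD(3)[OF \<mu>]) (simp add: discount_tail_nonneg)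
    finally show ?case by simp
  qed
  moreover have "(\<lambda>n. 2 * discount_tail \<gamma> (Suc (length h) + n) * \<mu> h) \<longlonglongrightarrow> 0" for h
    using LIMSEQ_ignore_initial_segment[OF discount_tail_tendsto_0, of "Suc (length h)"]
    by (auto intro!: tendsto_eq_intros simp: add.commute)
  ultimately have "S h - ?W ?\<pi> h \<le> 0" for h
    by (meson LIMSEQ_le_const)
  then have "?W \<pi> h \<le> ?W ?\<pi> h" for \<pi> h using le_S[of \<pi> h] by (smt (verit))
  then show ?thesis by blast
qed

lemma raw_return_nonneg:
  assumes "\<And>e. 0 \<le> r e"
  shows "0 \<le> raw_return \<gamma> r \<mu> \<pi> h"
  unfolding raw_return_def
  by (intro suminf_nonneg summable_step_return discount_nonneg mult_nonneg_nonneg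
      step_return_nonneg \<mu> assms)

end

section \<open>The dogmatic environment\<close>

definition follows :: "(('a, 'e) history \<Rightarrow> 'a) \<Rightarrow> ('a, 'e) history \<Rightarrow> bool" where
  "follows d h \<longleftrightarrow> (\<forall>i<length h. fst (h ! i) = d (take i h))"

lemma follows_Nil [simp]: "follows d []"
  by (simp add: follows_def)

lemma follows_snoc [simp]: "follows d (h @ [(a, e)]) \<longleftrightarrow> follows d h \<and> a = d h"
  by (auto simp: follows_def nth_append less_Suc_eq)

definition dogmatic_env :: "(('a, 'e) history \<Rightarrow> 'a) \<Rightarrow> nat \<Rightarrow> ('a::finite, 'e::finite) env" where
  "dogmatic_env d m h =
     (if length h \<le> m \<and> follows d h then (1 / real CARD('e)) ^ length h else 0)"

text \<open>Each successor of \<open>h\<close> gets at most the share \<open>1 / CARD('e)\<close> of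
  the mass of \<open>h\<close>.\<close>

lemma chronological_semimeasure_dogmatic_env:
  fixes d :: "('a::finite, 'e::finite) history \<Rightarrow> 'a"
  shows "chronological_semimeasure (dogmatic_env d m)"
proof -
  have "(\<Sum>e\<in>UNIV. dogmatic_env d m (h @ [(a, e)])) \<le> dogmatic_env d m h" for h a
  proof -
    let ?c = "1 / real CARD('e)"
    have "(\<Sum>e\<in>UNIV. dogmatic_env d m (h @ [(a, e)])) \<le> (\<Sum>e::'e\<in>UNIV. dogmatic_env d m h * ?c)"
      by (intro sum_mono) (auto simp: dogmatic_env_def)
    then show ?thesis by simp
  qed
  then show ?thesis
    by (auto simp: chronological_semimeasure_def dogmatic_env_def power_le_one)
qed

text \<open>\<open>d\<close> may be incomputable: only its finitely many values on histories shorter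
  than \<open>m\<close> enter, as part of a finite table.\<close>

lemma dogmatic_env_in_lsc_envs:
  fixes d :: "('a::finite, 'e::finite) history \<Rightarrow> 'a"
  shows "dogmatic_env d m \<in> lsc_envs"
proof -
  have "lower_semicomputable history_encode (dogmatic_env d m :: ('a, 'e) env)"
  proof (rule lower_semicomputable_finite_support)
    have "finite {h :: ('a, 'e) history. set h \<subseteq> UNIV \<and> length h \<le> m}"
      by (rule finite_lists_length_le) simp
    then show "finite {h :: ('a, 'e) history. length h \<le> m}" by simp
  qed (auto simp: dogmatic_env_def)
  then show ?thesis by (simp add: lsc_envs_def chronological_semimeasure_dogmatic_env)
qed

section \<open>Optimality in terms of returns, and returns of policies that follow
  \<open>d\<close>\<close>

context bounded_return
begin

text \<open>The return is linear in the environment, so \<open>1 / \<mu> h\<close> factors out. For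
  \<open>\<mu> h = 0\<close> both sides are \<open>0\<close>, as division by zero gives
  \<open>0\<close>.\<close>

lemma policy_value_eq:
  "policy_value \<gamma> r \<mu> \<pi> h = (if discount_tail \<gamma> (Suc (length h)) > 0
     then raw_return \<gamma> r \<mu> \<pi> h / (\<mu> h * discount_tail \<gamma> (Suc (length h))) else 0)"
proof -
  have "step_return r (\<lambda>g. \<mu> g / \<mu> h) \<pi> n h = step_return r \<mu> \<pi> n h / \<mu> h" for n
    by (simp add: step_return_def sum_divide_distrib)
  then have "raw_return \<gamma> r (\<lambda>g. \<mu> g / \<mu> h) \<pi> h = raw_return \<gamma> r \<mu> \<pi> h / \<mu> h"
    using suminf_divide[OF summable_step_return[of "Suc (length h)" \<pi> h], of "\<mu> h"]
    by (simp add: raw_return_def)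
  then show ?thesis by (simp add: policy_value_def expected_return_eq_raw_return)
qed

text \<open>Where mass and remaining discount are positive, value and return differ by a positive
  factor. Where no discount is left, all values are \<open>0\<close> and every policy is
  optimal.\<close>

lemma optimal_policy_iff:
  "optimal_policy \<gamma> r \<mu> \<pi> \<longleftrightarrow> (\<forall>h. \<mu> h > 0 \<longrightarrow> discount_tail \<gamma> (Suc (length h)) > 0 \<longrightarrow>
     (\<forall>\<pi>'. raw_return \<gamma> r \<mu> \<pi>' h \<le> raw_return \<gamma> r \<mu> \<pi> h))"
proof -
  have "policy_value \<gamma> r \<mu> \<pi> h = optimal_value \<gamma> r \<mu> h \<longleftrightarrow>
      (discount_tail \<gamma> (Suc (length h)) > 0 \<longrightarrow> (\<forall>\<pi>'. raw_return \<gamma> r \<mu> \<pi>' h \<le> raw_return \<gamma> r \<mu> \<pi> h))"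
    if h: "\<mu> h > 0" for h
  proof (cases "discount_tail \<gamma> (Suc (length h)) > 0")
    case pos: True
    let ?V = "\<lambda>\<pi>. policy_value \<gamma> r \<mu> \<pi> h"
    have le_iff: "?V \<pi>' \<le> ?V \<pi> \<longleftrightarrow> raw_return \<gamma> r \<mu> \<pi>' h \<le> raw_return \<gamma> r \<mu> \<pi> h" for \<pi>' \<pi>
      using h pos by (simp add: policy_value_eq divide_le_cancel zero_less_mult_iff mult_less_0_iff)
    obtain d where d: "\<And>\<pi>'. ?V \<pi>' \<le> ?V (\<lambda>h. return_pmf (d h))"
      using exists_deterministic_optimal le_iff by blast
    \<comment> \<open>The existing maximiser bounds the values, as the supremum of reals
      requires.\<close>
    then have "bdd_above (range ?V)" by (intro bdd_aboveI2)
    then have "?V \<pi> = (SUP \<pi>. ?V \<pi>) \<longleftrightarrow> (\<forall>\<pi>'. ?V \<pi>' \<le> ?V \<pi>)"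
      by (metis UNIV_I UNIV_not_empty antisym cSUP_least cSUP_upper)
    with pos show ?thesis by (simp add: optimal_value_def le_iff)
  qed (simp add: optimal_value_def policy_value_eq)
  then show ?thesis unfolding optimal_policy_def by blast
qed

lemma optimal_policy_exists: "\<exists>\<pi>. optimal_policy \<gamma> r \<mu> \<pi>"
  unfolding optimal_policy_iff
  using exists_deterministic_optimal by blast

text \<open>The return of \<open>\<pi>\<close> is an average in which the term of \<open>a\<close>
  is at most the maximum and every other term is at most
  \<open>discount_tail \<gamma> (Suc (length h)) * \<beta>\<close>, strictly below the maximum.
  Hence the others have weight \<open>0\<close>.\<close>

lemma maximiser_plays_dominant_action:
  assumes opt: "\<And>\<pi>'. raw_return \<gamma> r \<mu> \<pi>' h \<le> raw_return \<gamma> r \<mu> \<pi> h"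
    and small: "\<And>b. b \<noteq> a \<Longrightarrow> (\<Sum>e\<in>UNIV. \<mu> (h @ [(b, e)])) \<le> \<beta>"
    and large: "discount_tail \<gamma> (Suc (length h)) * \<beta> < raw_return \<gamma> r \<mu> \<pi>' h"
  shows "\<pi> h = return_pmf a"
proof -
  let ?W = "raw_return \<gamma> r \<mu>" and ?t = "Suc (length h)"
  let ?B = "discount_tail \<gamma> ?t * \<beta>"
  define q where "q b = (\<Sum>e\<in>UNIV. \<gamma> ?t * (r e * \<mu> (h @ [(b, e)])) + ?W \<pi> (h @ [(b, e)]))" for b
  have W: "?W \<pi> h = (\<Sum>b\<in>UNIV. pmf (\<pi> h) b * q b)"
    unfolding q_def by (rule raw_return_step)
  have q_le: "q b \<le> ?B" if "b \<noteq> a" for b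
  proof -
    have "\<gamma> ?t * (r e * \<mu> (h @ [(b, e)])) + ?W \<pi> (h @ [(b, e)]) \<le> discount_tail \<gamma> ?t * \<mu> (h @ [(b, e)])" for e
    proof -
      have "\<gamma> ?t * (r e * \<mu> (h @ [(b, e)])) \<le> \<gamma> ?t * (1 * \<mu> (h @ [(b, e)]))"
        using r[of e] chronological_semimeasureD(1)[OF \<mu>]
        by (intro mult_left_mono mult_right_mono discount_nonneg) auto
      moreover have "?W \<pi> (h @ [(b, e)]) \<le> discount_tail \<gamma> (Suc ?t) * \<mu> (h @ [(b, e)])"
        using raw_return_abs_le[of \<pi> "h @ [(b, e)]"]
        by simp
      ultimately show ?thesis
        using discount_tail_Suc[of ?t]
        by (simp add: algebra_simps)
    qed
    then have "q b \<le> (\<Sum>e\<in>UNIV. discount_tail \<gamma> ?t * \<mu> (h @ [(b, e)]))"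
      unfolding q_def by (rule sum_mono)
    also have "\<dots> \<le> ?B"
      unfolding sum_distrib_left[symmetric]
      by (intro mult_left_mono small that discount_tail_nonneg)
    finally show ?thesis .
  qed
  \<comment> \<open>Altering \<open>\<pi>\<close> at \<open>h\<close> alone makes \<open>q a\<close>
    the return of an actual policy, to which optimality applies.\<close>
  have "?W \<pi> (h @ [(a, e)]) = ?W (\<pi>(h := return_pmf a)) (h @ [(a, e)])" for e
    by (rule raw_return_cong) simp
  then have "q a = ?W (\<pi>(h := return_pmf a)) h"
    unfolding q_def
    by (subst raw_return_step_return_pmf[of "\<pi>(h := return_pmf a)" h a])
      simp_all
  with opt have q_a: "q a \<le> ?W \<pi> h" by simp
  let ?p = "pmf (\<pi> h)"
  have rest: "(\<Sum>b\<in>UNIV - {a}. ?p b) = 1 - ?p a"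
    using sum.remove[of UNIV a ?p] by (simp add: sum_pmf_eq_1)
  have "?W \<pi> h = ?p a * q a + (\<Sum>b\<in>UNIV - {a}. ?p b * q b)"
    unfolding W using sum.remove[of UNIV a "\<lambda>b. ?p b * q b"] by simp
  also have "\<dots> \<le> ?p a * ?W \<pi> h + (\<Sum>b\<in>UNIV - {a}. ?p b * ?B)"
    by (intro add_mono sum_mono mult_left_mono q_a q_le) auto
  also have "\<dots> = ?p a * ?W \<pi> h + (1 - ?p a) * ?B"
    by (simp add: rest flip: sum_distrib_right)
  finally have "(1 - ?p a) * (?W \<pi> h - ?B) \<le> 0" by (simp add: algebra_simps)
  moreover have "?W \<pi> h - ?B > 0" using large opt[of \<pi>'] by simp
  ultimately have "1 - ?p a \<le> 0" by (simp add: mult_le_0_iff)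
  then have "?p a = 1" using pmf_le_1[of "\<pi> h" a] by simp
  with rest have "\<forall>b\<in>UNIV - {a}. ?p b = 0"
    by (subst sum_nonneg_eq_0_iff[symmetric]) auto
  then have "set_pmf (\<pi> h) \<subseteq> {a}" by (auto simp: set_pmf_iff)
  then show ?thesis by (rule set_pmf_subset_singleton[THEN iffD1])
qed

text \<open>While both policies act alike, the gap between their returns is passed on to the
  successors. At length \<open>m\<close> it is at most the remaining discount times the mass, since
  the return of \<open>d\<close> is nonnegative.\<close>

lemma raw_return_le_if_agree:
  assumes r_nonneg: "\<And>e. 0 \<le> r e"
    and agree: "\<And>h. follows d h \<Longrightarrow> length h < m \<Longrightarrow> \<pi> h = return_pmf (d h)"
  shows "raw_return \<gamma> r \<mu> \<pi> [] \<le> raw_return \<gamma> r \<mu> (\<lambda>h. return_pmf (d h)) [] + discount_tail \<gamma> (Suc m)"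
proof -
  let ?W = "raw_return \<gamma> r \<mu>" and ?\<pi> = "\<lambda>h. return_pmf (d h)"
  note step = raw_return_step_return_pmf
  have "?W \<pi> h \<le> ?W ?\<pi> h + discount_tail \<gamma> (Suc m) * \<mu> h" if "follows d h" "length h \<le> m" for h
    using that(2,1)
  proof (induction rule: measure_induct_rule[where f = "\<lambda>h. m - length h"])
    case (less h)
    show ?case
    proof (cases "length h = m")
      case True
      with raw_return_nonneg[OF r_nonneg, of ?\<pi> h] raw_return_abs_le[of \<pi> h] True
      show ?thesis by simp
    next
      case False
      with less.prems have m: "length h < m" by simp
      let ?c = "discount_tail \<gamma> (Suc m)"
      have "?W \<pi> h = (\<Sum>e\<in>UNIV. \<gamma> (Suc (length h)) * (r e * \<mu> (h @ [(d h, e)])) + ?W \<pi> (h @ [(d h, e)]))"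
        by (rule step[OF agree]) (use less.prems m in auto)
      also have "\<dots> \<le> (\<Sum>e\<in>UNIV. \<gamma> (Suc (length h)) * (r e * \<mu> (h @ [(d h, e)]))
            + (?W ?\<pi> (h @ [(d h, e)]) + ?c * \<mu> (h @ [(d h, e)])))"
        using less.prems m by (intro sum_mono add_left_mono less.IH) auto
      also have "\<dots> = ?W ?\<pi> h + ?c * (\<Sum>e\<in>UNIV. \<mu> (h @ [(d h, e)]))"
        by (subst step[of ?\<pi> h "d h"]) (simp_all add: sum.distrib sum_distrib_left)
      also have "\<dots> \<le> ?W ?\<pi> h + ?c * \<mu> h"
        by (intro add_left_mono mult_left_mono chronological_semimeasureD(3)[OF \<mu>] discount_tail_nonneg)
      finally show ?thesis .
    qed
  qed
  from this[of "[]"] have "?W \<pi> [] \<le> ?W ?\<pi> [] + discount_tail \<gamma> (Suc m) * \<mu> []" by simp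
  also have "\<dots> \<le> ?W ?\<pi> [] + discount_tail \<gamma> (Suc m) * 1"
    by (intro add_left_mono mult_left_mono chronological_semimeasureD(2)[OF \<mu>] discount_tail_nonneg)
  finally show ?thesis by simp
qed

text \<open>A single future is kept: from \<open>h\<close> on, \<open>d\<close> meets the percept
  \<open>e\<close> at every step up to \<open>m\<close>, and only the reward at step
  \<open>m\<close> is counted. All other terms are nonnegative.\<close>

lemma raw_return_follow_ge:
  assumes r_nonneg: "\<And>e. 0 \<le> r e"
    and \<mu>_ge: "\<And>h. c * dogmatic_env d m h \<le> \<mu> h" and "0 \<le> c"
    and h: "follows d h" "length h < m"
  shows "\<gamma> m * r e * c * (1 / real CARD('e)) ^ m \<le> raw_return \<gamma> r \<mu> (\<lambda>h. return_pmf (d h)) h"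
  using h(2,1)
proof (induction rule: measure_induct_rule[where f = "\<lambda>h. m - length h"])
  case (less h)
  let ?W = "raw_return \<gamma> r \<mu> (\<lambda>h. return_pmf (d h))"
  let ?h = "h @ [(d h, e)]"
  let ?f = "\<lambda>e. \<gamma> (Suc (length h)) * (r e * \<mu> (h @ [(d h, e)])) + ?W (h @ [(d h, e)])"
  have f_nonneg: "0 \<le> ?f e" for e
    by (intro add_nonneg_nonneg mult_nonneg_nonneg discount_nonneg raw_return_nonneg r_nonneg
        chronological_semimeasureD(1)[OF \<mu>])
  have "?f e \<le> (\<Sum>e\<in>UNIV. ?f e)"
    by (rule member_le_sum[of e UNIV ?f]) (use f_nonneg in auto)
  also have "\<dots> = ?W h"
    by (rule raw_return_step_return_pmf[symmetric]) simp
  finally have W_ge: "?f e \<le> ?W h" .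
  show ?case
  proof (cases "Suc (length h) = m")
    \<comment> \<open>The next step is step \<open>m\<close>, the last one at which the dogmatic
      environment still has mass.\<close>
    case True
    have "c * (1 / real CARD('e)) ^ m \<le> \<mu> ?h"
      using \<mu>_ge[of ?h] less.prems True by (simp add: dogmatic_env_def)
    then have "\<gamma> m * (r e * (c * (1 / real CARD('e)) ^ m)) \<le> \<gamma> m * (r e * \<mu> ?h)"
      by (intro mult_left_mono discount_nonneg r_nonneg)
    with W_ge raw_return_nonneg[OF r_nonneg, of "\<lambda>h. return_pmf (d h)" ?h] True show ?thesis by (simp add: mult.assoc)
  next
    case False
    then have "\<gamma> m * r e * c * (1 / real CARD('e)) ^ m \<le> ?W ?h"
      using less.prems by (intro less.IH) auto
    also have "\<dots> \<le> ?f e"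
      by (simp add: discount_nonneg r_nonneg chronological_semimeasureD(1)[OF \<mu>])
    finally show ?thesis using W_ge by simp
  qed
qed

end

section \<open>Mixtures and their intelligence\<close>

lemma integrable_measure_pmf_bounded:
  fixes f :: "'x \<Rightarrow> real"
  assumes "\<And>x. x \<in> set_pmf p \<Longrightarrow> \<bar>f x\<bar> \<le> C"
  shows "integrable (measure_pmf p) f"
  using assms by (intro measure_pmf.integrable_const_bound[of _ C]) (auto simp: AE_measure_pmf_iff)

text \<open>Links the infinite sums in \<open>mixture\<close> and \<open>intelligence\<close> to
  integrals, for which linearity and the exchange with series are available.\<close>

lemma has_sum_pmf_expectation:
  fixes f :: "'x \<Rightarrow> real"
  assumes "\<And>x. x \<in> set_pmf p \<Longrightarrow> \<bar>f x\<bar> \<le> C" and "set_pmf p \<subseteq> A"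
  shows "((\<lambda>x. pmf p x * f x) has_sum measure_pmf.expectation p f) A"
proof -
  have "integrable (density (count_space UNIV) (\<lambda>x. ennreal (pmf p x))) f"
    using integrable_measure_pmf_bounded[OF assms(1)] by (simp flip: measure_pmf_eq_density)
  then have "integrable (count_space UNIV) (\<lambda>x. pmf p x * f x)"
    by (subst (asm) integrable_density) auto
  then have abs: "Infinite_Set_Sum.abs_summable_on (\<lambda>x. pmf p x * f x) UNIV"
    by (simp add: Infinite_Set_Sum.abs_summable_on_def)
  then have "(\<lambda>x. pmf p x * f x) summable_on UNIV"
    using abs_summable_equivalent abs_summable_summable by blast
  then have "((\<lambda>x. pmf p x * f x) has_sum measure_pmf.expectation p f) UNIV"
    by (simp add: pmf_expectation_eq_infsetsum infsetsum_infsum[OF abs] has_sum_infsum)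
  also have "?this \<longleftrightarrow> ?thesis"
    using assms(2) by (intro has_sum_cong_neutral) (auto simp: set_pmf_iff)
  finally show ?thesis .
qed

lemma infsum_lsc_envs_eq_expectation:
  assumes "positive_prior w" and "\<And>\<nu>. \<nu> \<in> lsc_envs \<Longrightarrow> \<bar>f \<nu>\<bar> \<le> C"
  shows "(\<Sum>\<^sub>\<infinity>\<nu>\<in>lsc_envs. pmf w \<nu> * f \<nu>) = measure_pmf.expectation w f"
  using assms by (intro infsumI has_sum_pmf_expectation) (auto simp: positive_prior_def)

lemma lsc_envsD: "\<nu> \<in> lsc_envs \<Longrightarrow> chronological_semimeasure \<nu>"
  by (simp add: lsc_envs_def)

lemma lsc_envs_abs_le_1: "\<nu> \<in> lsc_envs \<Longrightarrow> \<bar>\<nu> h\<bar> \<le> 1"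
  using chronological_semimeasureD[OF lsc_envsD] by (metis abs_of_nonneg)

context
  fixes w :: "('a::finite, 'e::finite) env pmf"
  assumes prior: "positive_prior w"
begin

lemma mixture_eq_expectation: "mixture w h = measure_pmf.expectation w (\<lambda>\<nu>. \<nu> h)"
  unfolding mixture_def by (intro infsum_lsc_envs_eq_expectation[where C = 1] prior lsc_envs_abs_le_1)

lemma integrable_env: "integrable (measure_pmf w) (\<lambda>\<nu>. \<nu> h)"
  using prior lsc_envs_abs_le_1 by (intro integrable_measure_pmf_bounded[of _ _ 1]) (auto simp: positive_prior_def)

text \<open>The defining inequalities hold almost surely under the prior and survive
  integration.\<close>

lemma chronological_semimeasure_mixture: "chronological_semimeasure (mixture w)"
proof -
  have AE: "AE \<nu> in measure_pmf w. chronological_semimeasure \<nu>"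
    using prior lsc_envsD by (auto simp: AE_measure_pmf_iff positive_prior_def)
  have "0 \<le> mixture w h" for h
    unfolding mixture_eq_expectation
    using AE by (intro integral_nonneg_AE) (auto intro: chronological_semimeasureD elim: eventually_mono)
  moreover have "mixture w h \<le> 1" for h
    unfolding mixture_eq_expectation
    using AE by (intro measure_pmf.integral_le_const integrable_env)
     (auto intro: chronological_semimeasureD elim: eventually_mono)
  moreover have "(\<Sum>e\<in>UNIV. mixture w (h @ [(a, e)])) \<le> mixture w h" for h a
    unfolding mixture_eq_expectation
    using AE
    by (subst Bochner_Integration.integral_sum[symmetric])
     (auto intro!: integral_mono_AE integrable_env Bochner_Integration.integrable_sum
         intro: chronological_semimeasureD elim: eventually_mono)
  ultimately show ?thesis by (simp add: chronological_semimeasure_def)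
qed

lemma step_return_mixture:
  "step_return r (mixture w) \<pi> n h = measure_pmf.expectation w (\<lambda>\<nu>. step_return r \<nu> \<pi> n h)"
  unfolding step_return_def mixture_eq_expectation
  by (subst Bochner_Integration.integral_sum) (auto intro!: integrable_env)

text \<open>Expectation and series may be exchanged because the terms are dominated by the summable
  discount.\<close>

lemma raw_return_mixture:
  assumes "discount \<gamma>" and r: "\<And>e. \<bar>r e\<bar> \<le> 1"
  shows "raw_return \<gamma> r (mixture w) \<pi> h = measure_pmf.expectation w (\<lambda>\<nu>. raw_return \<gamma> r \<nu> \<pi> h)"
proof -
  interpret discount \<gamma> by fact
  let ?t = "Suc (length h)"
  let ?f = "\<lambda>n \<nu>. \<gamma> (?t + n) * step_return r \<nu> \<pi> n h"
  have le: "\<bar>?f n \<nu>\<bar> \<le> \<gamma> (?t + n)" if "\<nu> \<in> set_pmf w" for n \<nu>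
  proof -
    have \<nu>: "chronological_semimeasure \<nu>" using that prior lsc_envsD by (auto simp: positive_prior_def)
    have "\<bar>step_return r \<nu> \<pi> n h\<bar> \<le> 1"
      using step_return_abs_le[of \<nu> r \<pi> n h, OF \<nu> r] chronological_semimeasureD(2)[OF \<nu>, of h] by simp
    then show ?thesis using discount_nonneg[of "?t + n"] by (simp add: abs_mult mult_left_le)
  qed
  have int: "integrable (measure_pmf w) (?f n)" for n
    using le by (rule integrable_measure_pmf_bounded)
  have "measure_pmf.expectation w (\<lambda>\<nu>. \<Sum>n. ?f n \<nu>) = (\<Sum>n. measure_pmf.expectation w (?f n))"
  proof (rule integral_suminf[OF int])
    show "AE \<nu> in measure_pmf w. summable (\<lambda>n. norm (?f n \<nu>))"
      unfolding AE_measure_pmf_iff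
      using le by (auto intro!: summable_comparison_test'[OF summable_discount_shift[of ?t]])
    have "measure_pmf.expectation w (\<lambda>\<nu>. norm (?f n \<nu>)) \<le> \<gamma> (?t + n)" for n
      using le by (intro measure_pmf.integral_le_const integrable_norm int) (auto simp: AE_measure_pmf_iff)
    then show "summable (\<lambda>n. measure_pmf.expectation w (\<lambda>\<nu>. norm (?f n \<nu>)))"
      by (intro summable_comparison_test'[OF summable_discount_shift[of ?t]]) (auto simp: abs_of_nonneg)
  qed
  then show ?thesis
    unfolding raw_return_def step_return_mixture by simp
qed

text \<open>Neither side divides by the mass of the empty history, so linearity of the return in the
  environment suffices.\<close>

lemma intelligence_eq:
  assumes "discount \<gamma>" and r: "\<And>e. \<bar>r e\<bar> \<le> 1"
  shows "intelligence \<gamma> r w \<pi> = expected_return \<gamma> r (mixture w) \<pi> []"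
proof -
  interpret discount \<gamma> by fact
  have "\<bar>expected_return \<gamma> r \<nu> \<pi> []\<bar> \<le> 1" if "\<nu> \<in> lsc_envs" for \<nu> :: "('a, 'e) env"
  proof -
    interpret bounded_return \<gamma> r \<nu> using lsc_envsD[OF that] r by unfold_locales
    have "discount_tail \<gamma> 1 * \<nu> [] \<le> discount_tail \<gamma> 1 * 1"
      by (intro mult_left_mono chronological_semimeasureD(2)[OF \<mu>] discount_tail_nonneg)
    then show ?thesis
      using raw_return_abs_le[of \<pi> "[]"] by (simp add: expected_return_eq_raw_return)
  qed
  then have "intelligence \<gamma> r w \<pi> = measure_pmf.expectation w (\<lambda>\<nu>. expected_return \<gamma> r \<nu> \<pi> [])"
    unfolding intelligence_def by (intro infsum_lsc_envs_eq_expectation prior)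
  also have "\<dots> = expected_return \<gamma> r (mixture w) \<pi> []"
    by (simp add: expected_return_eq_raw_return raw_return_mixture[OF assms])
  finally show ?thesis .
qed

text \<open>A coin of bias \<open>\<delta>\<close> chooses between \<open>w\<close> and the point
  mass at \<open>\<nu>\<close>. The support stays the same, since \<open>\<nu>\<close> already
  belongs to it.\<close>

lemma positive_prior_perturb:
  assumes "\<nu> \<in> lsc_envs" and "0 < \<delta>" and "\<delta> < 1"
  obtains w' where "positive_prior w'" and "\<And>h. mixture w' h = \<delta> * mixture w h + (1 - \<delta>) * \<nu> h"
proof -
  define w' where "w' = bind_pmf (bernoulli_pmf \<delta>) (\<lambda>b. if b then w else return_pmf \<nu>)"
  have pmf: "pmf w' x = \<delta> * pmf w x + (1 - \<delta>) * indicator {\<nu>} x" for x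
    using assms by (simp add: w'_def pmf_bind indicator_def)
  have "positive_prior w'"
    using assms prior by (simp add: positive_prior_def w'_def set_pmf_bernoulli UNIV_bool insert_absorb)
  moreover have "mixture w' h = \<delta> * mixture w h + (1 - \<delta>) * \<nu> h" for h
  proof -
    have "((\<lambda>x. pmf w x * x h) has_sum mixture w h) lsc_envs"
      unfolding mixture_eq_expectation using prior
      by (intro has_sum_pmf_expectation[where C = 1]) (auto simp: positive_prior_def lsc_envs_abs_le_1)
    moreover have "((\<lambda>x. indicator {\<nu>} x * x h) has_sum \<nu> h) lsc_envs"
      using assms(1) by (intro has_sum_finite_neutralI[of "{\<nu>}"]) auto
    ultimately have "((\<lambda>x. \<delta> * (pmf w x * x h) + (1 - \<delta>) * (indicator {\<nu>} x * x h))
        has_sum (\<delta> * mixture w h + (1 - \<delta>) * \<nu> h)) lsc_envs"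
      by (intro has_sum_add has_sum_cmult_right)
    then show ?thesis
      unfolding mixture_def[of w'] by (intro infsumI) (simp add: pmf algebra_simps)
  qed
  ultimately show ?thesis by (rule that)
qed

end

section \<open>Choice of the horizon and of the weight of the dogmatic environment\<close>

theorem corollary5p15:
  fixes r :: "'e::finite \<Rightarrow> real"
    and \<gamma> :: "nat \<Rightarrow> real"
    and w :: "('a::finite, 'e) env pmf"
    and \<epsilon> :: real
  assumes reward: "\<And>e. 0 \<le> r e \<and> r e \<le> 1"
    and discount_nonneg: "\<And>k. 0 \<le> \<gamma> k"
    and discount_computable: "computable_real_fun (\<lambda>k. k) \<gamma>"
    and discount_summable: "summable \<gamma>"
    and prior: "positive_prior w"
    and eps: "\<epsilon> > 0"
  shows "\<exists>w' :: ('a, 'e) env pmf. positive_prior w' \<and>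
           (\<exists>\<pi>. optimal_policy \<gamma> r (mixture w') \<pi>) \<and>
           (\<forall>\<pi>. optimal_policy \<gamma> r (mixture w') \<pi> \<longrightarrow>
              intelligence \<gamma> r w \<pi> < min_intelligence \<gamma> r w + \<epsilon>)"
proof -
  have r: "\<bar>r e\<bar> \<le> 1" and r_nonneg: "0 \<le> r e" for e using reward[of e] by auto
  interpret discount \<gamma> using discount_nonneg discount_summable by unfold_locales
  define \<xi> where "\<xi> = mixture w"
  have \<xi>: "chronological_semimeasure \<xi>"
    unfolding \<xi>_def by (rule chronological_semimeasure_mixture[OF prior])
  interpret \<xi>: bounded_return \<gamma> r \<xi> using \<xi> r by unfold_locales
  \<comment> \<open>A maximiser for the negated reward is a policy of least return in
    \<open>\<xi>\<close>.\<close>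
  interpret \<xi>_neg: bounded_return \<gamma> "\<lambda>e. - r e" \<xi> using \<xi> r by unfold_locales auto
  let ?\<Gamma> = "discount_tail \<gamma> (Suc 0)"
  have intel: "intelligence \<gamma> r w \<pi> = (if ?\<Gamma> > 0 then raw_return \<gamma> r \<xi> \<pi> [] / ?\<Gamma> else 0)" for \<pi>
    using intelligence_eq[of w \<gamma> r \<pi>, OF prior discount_axioms r]
    by (simp add: expected_return_eq_raw_return \<xi>_def)
  have exists_optimal: "\<exists>\<pi>. optimal_policy \<gamma> r (mixture w') \<pi>" if "positive_prior w'" for w' :: "('a, 'e) env pmf"
  proof -
    interpret bounded_return \<gamma> r "mixture w'"
      using chronological_semimeasure_mixture[OF that] r by unfold_locales
    show ?thesis by (rule optimal_policy_exists)
  qed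
  have step_neg: "step_return (\<lambda>e. - r e) \<xi> \<pi> n h = - step_return r \<xi> \<pi> n h" for \<pi> n h
    by (simp add: step_return_def sum_negf)
  have raw_neg: "raw_return \<gamma> (\<lambda>e. - r e) \<xi> \<pi> h = - raw_return \<gamma> r \<xi> \<pi> h" for \<pi> h
    unfolding raw_return_def step_neg mult_minus_right by (rule suminf_minus[OF \<xi>.summable_step_return])
  obtain d where d: "\<And>\<pi> h. raw_return \<gamma> r \<xi> (\<lambda>h. return_pmf (d h)) h \<le> raw_return \<gamma> r \<xi> \<pi> h"
    using \<xi>_neg.exists_deterministic_optimal unfolding raw_neg by auto
  let ?d = "\<lambda>h. return_pmf (d h)"
  have min_ge: "intelligence \<gamma> r w ?d \<le> min_intelligence \<gamma> r w"
    unfolding min_intelligence_def using d[of "[]"]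
    by (intro cINF_greatest) (auto simp: intel divide_right_mono)
  show ?thesis
  proof (cases "?\<Gamma> > 0 \<and> (\<exists>e. r e \<noteq> 0)")
    case False
    \<comment> \<open>With no discount or no nonzero reward every intelligence is \<open>0\<close>,
      and \<open>w\<close> itself serves as the new prior.\<close>
    have zero: "intelligence \<gamma> r w \<pi> = 0" for \<pi>
    proof (cases "?\<Gamma> > 0")
      case True
      with False have "\<And>e. r e = 0" by blast
      then show ?thesis by (simp add: intel raw_return_def step_return_def)
    qed (simp add: intel)
    then show ?thesis using prior exists_optimal eps min_ge by (intro exI[of _ w]) auto
  next
    case True
    then have \<Gamma>: "?\<Gamma> > 0" by blast
    obtain e where e: "0 < r e" using True r_nonneg by (metis less_eq_real_def)
    \<comment> \<open>The slack for unnormalised returns, hence the factor \<open>?\<Gamma>\<close>.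
      The cap by \<open>1\<close> gives \<open>\<eta> \<le> ?\<Gamma>\<close>, which excludes
      \<open>m = 0\<close>.\<close>
    define \<eta> where "\<eta> = min \<epsilon> 1 * ?\<Gamma>"
    have "\<eta> > 0" using eps \<Gamma> by (simp add: \<eta>_def)
    then have "\<exists>m. discount_tail \<gamma> (Suc m) < \<eta>"
      using order_tendstoD(2)[OF LIMSEQ_Suc[OF discount_tail_tendsto_0]]
      by (auto simp: eventually_sequentially)
    \<comment> \<open>Minimality will make \<open>\<gamma> m\<close> positive, as the difference of
      a tail of at least \<open>\<eta>\<close> and one below \<open>\<eta>\<close>.\<close>
    then obtain m where m: "discount_tail \<gamma> (Suc m) < \<eta>"
      and m_least: "\<And>k. k < m \<Longrightarrow> \<eta> \<le> discount_tail \<gamma> (Suc k)"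
      using LeastI_ex[of "\<lambda>m. discount_tail \<gamma> (Suc m) < \<eta>"] not_less_Least[of _ "\<lambda>m. discount_tail \<gamma> (Suc m) < \<eta>"]
      by (metis not_less)
    have "m \<noteq> 0"
    proof
      assume "m = 0"
      moreover have "\<eta> \<le> 1 * ?\<Gamma>" unfolding \<eta>_def using \<Gamma> by (intro mult_right_mono) auto
      ultimately show False using m by simp
    qed
    then have "\<eta> \<le> discount_tail \<gamma> m" using m_least[of "m - 1"] by simp
    then have \<gamma>_m: "\<gamma> m > 0" using m discount_tail_Suc[of m] by simp
    \<comment> \<open>\<open>(1 - \<delta>) * L\<close> will bound the return of following
      \<open>d\<close> in \<open>mixture w'\<close> from below.\<close>
    define L where "L = \<gamma> m * r e * (1 / real CARD('e)) ^ m"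
    have L: "L > 0" unfolding L_def using \<gamma>_m e by simp
    \<comment> \<open>Chosen so that \<open>\<delta> * (?\<Gamma> + L)\<close> stays below
      \<open>L\<close>; then deviating, worth at most \<open>?\<Gamma> * \<delta>\<close>, earns
      less than following \<open>d\<close>.\<close>
    define \<delta> where "\<delta> = L / (2 * (?\<Gamma> + L))"
    have "0 < \<delta>" "\<delta> < 1" and \<delta>_mult: "\<delta> * (?\<Gamma> + L) = L / 2"
      using L \<Gamma> by (auto simp: \<delta>_def divide_simps)
    then have \<delta>: "0 < \<delta>" "\<delta> < 1" "?\<Gamma> * \<delta> < (1 - \<delta>) * L"
      using L by (auto simp: algebra_simps)
    obtain w' where w': "positive_prior w'"
      and mix: "\<And>h. mixture w' h = \<delta> * \<xi> h + (1 - \<delta>) * dogmatic_env d m h"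
      using positive_prior_perturb[OF prior dogmatic_env_in_lsc_envs \<delta>(1,2)] unfolding \<xi>_def by metis
    interpret \<mu>: bounded_return \<gamma> r "mixture w'"
      using chronological_semimeasure_mixture[OF w'] r by unfold_locales
    have mix_ge: "(1 - \<delta>) * dogmatic_env d m h \<le> mixture w' h" for h
      using mix[of h] \<delta> chronological_semimeasureD(1)[OF \<xi>, of h] by simp
    have "intelligence \<gamma> r w \<pi> < min_intelligence \<gamma> r w + \<epsilon>" if opt: "optimal_policy \<gamma> r (mixture w') \<pi>" for \<pi>
    proof -
      have agree: "\<pi> h = return_pmf (d h)" if h: "follows d h" "length h < m" for h
      proof (rule \<mu>.maximiser_plays_dominant_action)
        \<comment> \<open>The discount left after \<open>h\<close> includes
          \<open>\<gamma> m\<close>, so optimality at \<open>h\<close> says something.\<close>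
        have "\<gamma> m \<le> discount_tail \<gamma> (Suc (length h))"
          using discount_tail_Suc[of m] discount_tail_nonneg[of "Suc m"]
            discount_tail_antimono[of "Suc (length h)" m] h(2) by simp
        moreover have "mixture w' h > 0"
          using h \<delta> by (intro less_le_trans[OF _ mix_ge]) (simp add: dogmatic_env_def)
        ultimately show "raw_return \<gamma> r (mixture w') \<pi>' h \<le> raw_return \<gamma> r (mixture w') \<pi> h" for \<pi>'
          using opt \<gamma>_m unfolding \<mu>.optimal_policy_iff by simp
      next
        fix b assume "b \<noteq> d h"
        \<comment> \<open>The deviation kills the dogmatic part and leaves the share
          \<open>\<delta>\<close> of \<open>\<xi>\<close>.\<close>
        then have "(\<Sum>e\<in>UNIV. mixture w' (h @ [(b, e)])) = \<delta> * (\<Sum>e\<in>UNIV. \<xi> (h @ [(b, e)]))"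
          by (simp add: mix dogmatic_env_def sum_distrib_left)
        also have "\<dots> \<le> \<delta> * 1"
          using \<delta> chronological_semimeasureD(2,3)[OF \<xi>] by (intro mult_left_mono) (auto intro: order_trans)
        finally show "(\<Sum>e\<in>UNIV. mixture w' (h @ [(b, e)])) \<le> \<delta>" by simp
      next
        have "discount_tail \<gamma> (Suc (length h)) * \<delta> \<le> ?\<Gamma> * \<delta>"
          using \<delta> discount_tail_antimono[of "Suc 0" "Suc (length h)"] by (intro mult_right_mono) auto
        also note \<delta>(3)
        also have "(1 - \<delta>) * L \<le> raw_return \<gamma> r (mixture w') ?d h"
          using \<mu>.raw_return_follow_ge[OF r_nonneg mix_ge _ h, of e] \<delta> by (simp add: L_def mult_ac)
        finally show "discount_tail \<gamma> (Suc (length h)) * \<delta> < raw_return \<gamma> r (mixture w') ?d h" .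
      qed
      \<comment> \<open>Agreement was forced in \<open>mixture w'\<close>; the returns are now
        compared in \<open>\<xi>\<close>, where \<open>d\<close> is minimal.\<close>
      have "raw_return \<gamma> r \<xi> \<pi> [] \<le> raw_return \<gamma> r \<xi> ?d [] + discount_tail \<gamma> (Suc m)"
        by (rule \<xi>.raw_return_le_if_agree[OF r_nonneg agree])
      moreover have "\<eta> \<le> \<epsilon> * ?\<Gamma>"
        unfolding \<eta>_def using \<Gamma> by (intro mult_right_mono) auto
      ultimately have "raw_return \<gamma> r \<xi> \<pi> [] < raw_return \<gamma> r \<xi> ?d [] + \<epsilon> * ?\<Gamma>"
        using m by simp
      then have "intelligence \<gamma> r w \<pi> < intelligence \<gamma> r w ?d + \<epsilon>"
        using \<Gamma> by (simp add: intel field_simps)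
      then show ?thesis using min_ge by linarith
    qed
    with w' exists_optimal show ?thesis by blast
  qed
qed

end
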